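(* For all patterns $l$, sets of equations $\mathcal{E}$, and terms $T,r$ in $\Lambda$, if $l\uparrow T[\mathcal{E}]$ and $\vdash_{l,\mathcal{E}} r:T$, then $l\hookrightarrow r$ preserves typing in $\Lambda$.
   Context: Setting: a $\lambda\Pi$-calculus modulo rewriting $\Lambda=(\mathcal{F},\mathcal{V},\Theta,\Sigma,\mathcal{R})$, i.e. a Pure Type System with sorts $\{\star,\Box\}$, terms $t,u ::= s \mid x \mid f \mid \lambda x:t,u \mid tu \mid \Pi x:t,u$, each function symbol $f$ having a type $\Theta_f$ and a sort $\Sigma_f$, a set $\mathcal{R}$ of rewriting rules $l\hookrightarrow r$ with $\mathrm{FV}(r)\subseteq\mathrm{FV}(l)$, conversion $\simeq$ the equivalence closure of $\hookrightarrow_\beta\cup\hookrightarrow_{\mathcal{R}}$, and the usual typing rules (ax, fun, var, weak, prod, app, abs, conv modulo $\simeq$). Standing assumptions: $\vdash\Theta_f:\Sigma_f$ for every $f$; $\hookrightarrow=\hookrightarrow_\beta\cup\hookrightarrow_{\mathcal{R}}$ is confluent on untyped terms; every rule left-hand side is a pattern. Variables are split into algebraic and non-algebraic ones, with an injection $x\mapsto\hat{x}$ from algebraic to non-algebraic variables. A term is algebraic if it is an algebraic variable or $f t_1\ldots t_n$ with each $t_i$ algebraic and $\Theta_f$ of the form $\Pi x_1:A_1,\ldots,x_n:A_n,B$; it is object-level algebraic if moreover all its function symbols have sort $\star$; a pattern is a term $f t_1\ldots t_n$ with each $t_i$ object-level algebraic. The typability-constraint function $\uparrow$ maps a term to a pair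 $A[\mathcal{E}]$ (a term and a set of equations): $y\uparrow \hat{y}[\emptyset]$; and if $f:\Pi x_1:T_1,\ldots,\Pi x_n:T_n,U$ and $t_i\uparrow A_i[\mathcal{E}_i]$ for all $i$, then $f t_1\ldots t_n\uparrow U\sigma[\mathcal{E}_1\cup\ldots\cup\mathcal{E}_n\cup\{A_1=T_1\sigma,\ldots,A_n=T_n\sigma\}]$ where $\sigma=\{(x_1,t_1),\ldots,(x_n,t_n)\}$. Given a pattern $l$ and a set of equations $\mathcal{E}$ (with variables renamed so that $\mathcal{R}$ uses none of $x,\hat{x}$ for $x\in\mathrm{FV}(l)$), $\Lambda_{l,\mathcal{E}}$ is the $\lambda\Pi$-calculus obtained from $\Lambda$ by turning each $x\in\mathrm{FV}(l)$ into a function symbol of type $\hat{x}$ and sort $\star$, each $\hat{x}$ into a function symbol of type $\star$ and sort $\Box$, and taking rules $\mathcal{R}\cup\mathcal{E}\cup\mathcal{E}^{-1}$; $\vdash_{l,\mathcal{E}}$ denotes its typing relation. A rule $l\hookrightarrow r$ preserves typing in $\Lambda$ if for all environments $\Gamma$, substitutions $\sigma$ and terms $A$, $\Gamma\vdash l\sigma:A$ implies $\Gamma\vdash r\sigma:A$. *)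

theory Defs
  imports Main "HOL-Library.Confluence"
begin

(* Terms up to alpha-equivalence, in de Bruijn notation: a free variable is a free index. *)

datatype srt = Star | Box

datatype (syms: 'f) tm =
    Sort srt
  | Var nat
  | Fn 'f
  | Lam "'f tm" "'f tm"
  | App "'f tm" "'f tm"
  | Pi "'f tm" "'f tm"

primrec FV :: "'f tm \<Rightarrow> nat set" where
  "FV (Sort s) = {}"
| "FV (Var x) = {x}"
| "FV (Fn f) = {}"
| "FV (Lam A t) = FV A \<union> {x. Suc x \<in> FV t}"
| "FV (App t u) = FV t \<union> FV u"
| "FV (Pi A B) = FV A \<union> {x. Suc x \<in> FV B}"

definition upr :: "(nat \<Rightarrow> nat) \<Rightarrow> nat \<Rightarrow> nat" where
  "upr \<rho> = case_nat 0 (\<lambda>n. Suc (\<rho> n))"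

primrec rename :: "(nat \<Rightarrow> nat) \<Rightarrow> 'f tm \<Rightarrow> 'f tm" where
  "rename \<rho> (Sort s) = Sort s"
| "rename \<rho> (Var x) = Var (\<rho> x)"
| "rename \<rho> (Fn f) = Fn f"
| "rename \<rho> (Lam A t) = Lam (rename \<rho> A) (rename (upr \<rho>) t)"
| "rename \<rho> (App t u) = App (rename \<rho> t) (rename \<rho> u)"
| "rename \<rho> (Pi A B) = Pi (rename \<rho> A) (rename (upr \<rho>) B)"

abbreviation lift :: "'f tm \<Rightarrow> 'f tm" where
  "lift \<equiv> rename Suc"

definition ups :: "(nat \<Rightarrow> 'f tm) \<Rightarrow> nat \<Rightarrow> 'f tm" where
  "ups \<sigma> = case_nat (Var 0) (\<lambda>n. lift (\<sigma> n))"

primrec subst :: "(nat \<Rightarrow> 'f tm) \<Rightarrow> 'f tm \<Rightarrow> 'f tm" where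
  "subst \<sigma> (Sort s) = Sort s"
| "subst \<sigma> (Var x) = \<sigma> x"
| "subst \<sigma> (Fn f) = Fn f"
| "subst \<sigma> (Lam A t) = Lam (subst \<sigma> A) (subst (ups \<sigma>) t)"
| "subst \<sigma> (App t u) = App (subst \<sigma> t) (subst \<sigma> u)"
| "subst \<sigma> (Pi A B) = Pi (subst \<sigma> A) (subst (ups \<sigma>) B)"

(* For a term under binders x_1, ..., x_n (x_n innermost, i.e. index 0), inst [t_1, ..., t_n]
   is the simultaneous substitution {(x_1,t_1), ..., (x_n,t_n)} that removes these binders. *)
definition inst :: "'f tm list \<Rightarrow> nat \<Rightarrow> 'f tm" where
  "inst ts n = (if n < length ts then rev ts ! n else Var (n - length ts))"

abbreviation Apps :: "'f \<Rightarrow> 'f tm list \<Rightarrow> 'f tm" where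
  "Apps f ts \<equiv> foldl App (Fn f) ts"

abbreviation Pis :: "'f tm list \<Rightarrow> 'f tm \<Rightarrow> 'f tm" where
  "Pis Ts U \<equiv> foldr Pi Ts U"


record 'f calculus =
  Funs :: "'f set"
  Typ :: "'f \<Rightarrow> 'f tm"
  Srt :: "'f \<Rightarrow> srt"
  Rules :: "('f tm \<times> 'f tm) set"

definition terms :: "'f calculus \<Rightarrow> 'f tm set" where
  "terms \<Lambda> = {t. syms t \<subseteq> Funs \<Lambda>}"

definition calculus_modulo :: "'f calculus \<Rightarrow> bool" where
  "calculus_modulo \<Lambda> \<longleftrightarrow>
     (\<forall>f\<in>Funs \<Lambda>. Typ \<Lambda> f \<in> terms \<Lambda>) \<and>
     (\<forall>(l, r)\<in>Rules \<Lambda>. l \<in> terms \<Lambda> \<and> r \<in> terms \<Lambda> \<and> FV r \<subseteq> FV l)"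

inductive step :: "('f tm \<times> 'f tm) set \<Rightarrow> 'f tm \<Rightarrow> 'f tm \<Rightarrow> bool" for R where
  beta: "step R (App (Lam A t) u) (subst (inst [u]) t)"
| rule: "(l, r) \<in> R \<Longrightarrow> step R (subst \<sigma> l) (subst \<sigma> r)"
| lam1: "step R A A' \<Longrightarrow> step R (Lam A t) (Lam A' t)"
| lam2: "step R t t' \<Longrightarrow> step R (Lam A t) (Lam A t')"
| app1: "step R t t' \<Longrightarrow> step R (App t u) (App t' u)"
| app2: "step R u u' \<Longrightarrow> step R (App t u) (App t u')"
| pi1: "step R A A' \<Longrightarrow> step R (Pi A B) (Pi A' B)"
| pi2: "step R B B' \<Longrightarrow> step R (Pi A B) (Pi A B')"

(* The type of symbols may be larger than Funs, hence the restriction to the terms of the calculus. *)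
definition red :: "'f calculus \<Rightarrow> 'f tm \<Rightarrow> 'f tm \<Rightarrow> bool" where
  "red \<Lambda> t u \<longleftrightarrow> t \<in> terms \<Lambda> \<and> u \<in> terms \<Lambda> \<and> step (Rules \<Lambda>) t u"

abbreviation conv :: "'f calculus \<Rightarrow> 'f tm \<Rightarrow> 'f tm \<Rightarrow> bool" where
  "conv \<Lambda> \<equiv> equivclp (red \<Lambda>)"

(* Environments list the types of the indices 0, 1, ...; the most recent declaration is the head,
   and freshness of a newly declared variable is automatic. *)
inductive typing :: "'f calculus \<Rightarrow> 'f tm list \<Rightarrow> 'f tm \<Rightarrow> 'f tm \<Rightarrow> bool" for \<Lambda> where
  ax: "typing \<Lambda> [] (Sort Star) (Sort Box)"
| "fun": "f \<in> Funs \<Lambda> \<Longrightarrow> typing \<Lambda> [] (Typ \<Lambda> f) (Sort (Srt \<Lambda> f)) \<Longrightarrow> typing \<Lambda> [] (Fn f) (Typ \<Lambda> f)"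
| var: "typing \<Lambda> \<Gamma> A (Sort s) \<Longrightarrow> typing \<Lambda> (A # \<Gamma>) (Var 0) (lift A)"
| weak: "typing \<Lambda> \<Gamma> A (Sort s) \<Longrightarrow> typing \<Lambda> \<Gamma> b B \<Longrightarrow> typing \<Lambda> (A # \<Gamma>) (lift b) (lift B)"
| prod: "typing \<Lambda> \<Gamma> A (Sort Star) \<Longrightarrow> typing \<Lambda> (A # \<Gamma>) B (Sort s) \<Longrightarrow> typing \<Lambda> \<Gamma> (Pi A B) (Sort s)"
| app: "typing \<Lambda> \<Gamma> t (Pi A B) \<Longrightarrow> typing \<Lambda> \<Gamma> a A \<Longrightarrow> typing \<Lambda> \<Gamma> (App t a) (subst (inst [a]) B)"
| abs: "typing \<Lambda> (A # \<Gamma>) b B \<Longrightarrow> typing \<Lambda> \<Gamma> (Pi A B) (Sort s) \<Longrightarrow> typing \<Lambda> \<Gamma> (Lam A b) (Pi A B)"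
| conv: "typing \<Lambda> \<Gamma> a A \<Longrightarrow> conv \<Lambda> A B \<Longrightarrow> typing \<Lambda> \<Gamma> B (Sort s) \<Longrightarrow> typing \<Lambda> \<Gamma> a B"


(* V is the set of algebraic variables. *)

inductive algebraic :: "'f calculus \<Rightarrow> nat set \<Rightarrow> 'f tm \<Rightarrow> bool" for \<Lambda> V where
  algebraic_var: "x \<in> V \<Longrightarrow> algebraic \<Lambda> V (Var x)"
| algebraic_fun: "f \<in> Funs \<Lambda> \<Longrightarrow> Typ \<Lambda> f = Pis Ts U \<Longrightarrow> length ts = length Ts \<Longrightarrow>
    \<forall>t\<in>set ts. algebraic \<Lambda> V t \<Longrightarrow> algebraic \<Lambda> V (Apps f ts)"

definition object_algebraic :: "'f calculus \<Rightarrow> nat set \<Rightarrow> 'f tm \<Rightarrow> bool" where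
  "object_algebraic \<Lambda> V t \<longleftrightarrow> algebraic \<Lambda> V t \<and> (\<forall>f\<in>syms t. Srt \<Lambda> f = Star)"

definition pattern :: "'f calculus \<Rightarrow> nat set \<Rightarrow> 'f tm \<Rightarrow> bool" where
  "pattern \<Lambda> V l \<longleftrightarrow>
     (\<exists>f ts. l = Apps f ts \<and> f \<in> Funs \<Lambda> \<and> (\<forall>t\<in>set ts. object_algebraic \<Lambda> V t))"

definition hat_map :: "nat set \<Rightarrow> (nat \<Rightarrow> nat) \<Rightarrow> bool" where
  "hat_map V hat \<longleftrightarrow> inj_on hat V \<and> hat ` V \<inter> V = {}"

(* As usual in a telescope, T_i only depends on x_1, ..., x_(i-1). *)
inductive constraints ::
    "'f calculus \<Rightarrow> nat set \<Rightarrow> (nat \<Rightarrow> nat) \<Rightarrow> 'f tm \<Rightarrow> 'f tm \<Rightarrow> ('f tm \<times> 'f tm) set \<Rightarrow> bool"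
  for \<Lambda> V hat where
  constraints_var: "y \<in> V \<Longrightarrow> constraints \<Lambda> V hat (Var y) (Var (hat y)) {}"
| constraints_fun: "f \<in> Funs \<Lambda> \<Longrightarrow> Typ \<Lambda> f = Pis Ts U \<Longrightarrow>
    length ts = length Ts \<Longrightarrow> length As = length Ts \<Longrightarrow> length Es = length Ts \<Longrightarrow>
    \<forall>i<length Ts. constraints \<Lambda> V hat (ts ! i) (As ! i) (Es ! i) \<Longrightarrow>
    constraints \<Lambda> V hat (Apps f ts) (subst (inst ts) U)
      (\<Union>(set Es) \<union> {(As ! i, subst (inst (take i ts)) (Ts ! i)) | i. i < length Ts})"


(* The symbols of the extended calculus are Inl f for the old symbols f and Inr x, Inr (hat x) for
   the variables x of l. The variables of the old rules are never turned into symbols, which is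
   the effect of first renaming them away from the variables of l and their hats. *)

definition symbolize :: "(nat \<Rightarrow> nat) \<Rightarrow> 'f tm \<Rightarrow> 'f tm \<Rightarrow> ('f + nat) tm" where
  "symbolize hat l t =
     subst (\<lambda>x. if x \<in> FV l \<union> hat ` FV l then Fn (Inr x) else Var x) (map_tm Inl t)"

definition extended_calculus ::
    "(nat \<Rightarrow> nat) \<Rightarrow> 'f calculus \<Rightarrow> 'f tm \<Rightarrow> ('f tm \<times> 'f tm) set \<Rightarrow> ('f + nat) calculus" where
  "extended_calculus hat \<Lambda> l E =
     (let E' = map_prod (symbolize hat l) (symbolize hat l) ` E in
      \<lparr> Funs = Inl ` Funs \<Lambda> \<union> Inr ` (FV l \<union> hat ` FV l),
        Typ = case_sum (\<lambda>f. map_tm Inl (Typ \<Lambda> f))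
                (\<lambda>x. if x \<in> FV l then Fn (Inr (hat x)) else Sort Star),
        Srt = case_sum (Srt \<Lambda>) (\<lambda>x. if x \<in> FV l then Star else Box),
        Rules = map_prod (map_tm Inl) (map_tm Inl) ` Rules \<Lambda> \<union> E' \<union> E'\<inverse> \<rparr>)"

definition preserves_typing :: "'f calculus \<Rightarrow> 'f tm \<Rightarrow> 'f tm \<Rightarrow> bool" where
  "preserves_typing \<Lambda> l r \<longleftrightarrow>
     (\<forall>\<Gamma> \<sigma> A. typing \<Lambda> \<Gamma> (subst \<sigma> l) A \<longrightarrow> typing \<Lambda> \<Gamma> (subst \<sigma> r) A)"

end

theory Submission
  imports Defs
begin

text \<open>Suppose that an instance \<open>l\<sigma>\<close> of the left-hand side has type \<open>A\<close>. Confluence makes products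
  injective up to conversion and types unique up to conversion. Inverting the typing of \<open>l\<sigma>\<close> along
  the pattern therefore gives each \<open>x\<sigma>\<close> with \<open>x\<close> in \<open>l\<close> a type of sort \<open>\<star>\<close>, and mapping each
  \<open>x\<close>-hat to that type solves all equations of \<open>\<E>\<close> up to conversion and makes the instance of \<open>T\<close>
  convertible to \<open>A\<close>. So replacing the symbols \<open>x\<close> and \<open>x\<close>-hat of the extended calculus by their
  values maps its derivations to derivations of the original calculus, and the given derivation
  of \<open>r : T\<close> becomes one of \<open>r\<sigma> : A\<close>.\<close>

section \<open>Interpretations of symbols and variables\<close>

text \<open>Substitution, and the translation of the extended calculus back into the original one, are both
  instances of the following map, which replaces the variables and the symbols of a term. Hence a
  single typing lemma covers weakening, substitution and the translation.\<close>

primrec interp :: "(nat \<Rightarrow> 'f tm) \<Rightarrow> ('g \<Rightarrow> 'f tm) \<Rightarrow> 'g tm \<Rightarrow> 'f tm" where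
  "interp \<sigma> \<theta> (Sort s) = Sort s"
| "interp \<sigma> \<theta> (Var x) = \<sigma> x"
| "interp \<sigma> \<theta> (Fn f) = \<theta> f"
| "interp \<sigma> \<theta> (Lam A t) = Lam (interp \<sigma> \<theta> A) (interp (ups \<sigma>) (\<lambda>f. lift (\<theta> f)) t)"
| "interp \<sigma> \<theta> (App t u) = App (interp \<sigma> \<theta> t) (interp \<sigma> \<theta> u)"
| "interp \<sigma> \<theta> (Pi A B) = Pi (interp \<sigma> \<theta> A) (interp (ups \<sigma>) (\<lambda>f. lift (\<theta> f)) B)"

section \<open>Composition laws for renaming, substitution and interpretation\<close>

lemma upr_simps [simp]: "upr \<rho> 0 = 0" "upr \<rho> (Suc n) = Suc (\<rho> n)"
  by (simp_all add: upr_def)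

lemma ups_simps [simp]: "ups \<sigma> 0 = Var 0" "ups \<sigma> (Suc n) = lift (\<sigma> n)"
  by (simp_all add: ups_def)

lemma inst_Nil [simp]: "inst [] = Var"
  by (auto simp: inst_def)

lemma inst_single [simp]: "inst [u] 0 = u" "inst [u] (Suc n) = Var n"
  by (simp_all add: inst_def)

lemma inst_snoc_simps [simp]: "inst (ts @ [u]) 0 = u" "inst (ts @ [u]) (Suc n) = inst ts n"
  by (simp_all add: inst_def)

lemma inst_map: "n < length ts \<Longrightarrow> inst (map h ts) n = h (inst ts n)"
  by (simp add: inst_def rev_map)

lemma inst_mem: "n < length ts \<Longrightarrow> inst ts n \<in> set ts"
  unfolding inst_def using nth_mem[of n "rev ts"] by simp

lemma upr_comp: "upr \<rho> (upr \<rho>' n) = upr (\<lambda>n. \<rho> (\<rho>' n)) n"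
  by (cases n) auto

lemma rename_rename: "rename \<rho> (rename \<rho>' t) = rename (\<lambda>n. \<rho> (\<rho>' n)) t"
  by (induction t arbitrary: \<rho> \<rho>') (simp_all add: upr_comp)

lemma rename_id [simp]: "rename (\<lambda>n. n) t = t"
proof -
  have *: "upr (\<lambda>n. n) = (\<lambda>n. n)"
    by (rule ext, rename_tac n, case_tac n) auto
  show ?thesis by (induction t) (simp_all add: *)
qed

text \<open>Below a binder the two assignments agree at index 0 by construction and elsewhere by
  assumption. On closed terms this allows the assignment of variables to be exchanged
  freely.\<close>

lemma interp_cong:
  "(\<And>x. x \<in> FV t \<Longrightarrow> \<sigma> x = \<sigma>' x) \<Longrightarrow> (\<And>f. f \<in> syms t \<Longrightarrow> \<theta> f = \<theta>' f) \<Longrightarrow>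
   interp \<sigma> \<theta> t = interp \<sigma>' \<theta>' t"
proof (induction t arbitrary: \<sigma> \<sigma>' \<theta> \<theta>')
  case (Lam A t)
  have "interp (ups \<sigma>) (\<lambda>f. lift (\<theta> f)) t = interp (ups \<sigma>') (\<lambda>f. lift (\<theta>' f)) t"
  proof (rule Lam.IH(2))
    show "ups \<sigma> x = ups \<sigma>' x" if "x \<in> FV t" for x
      using that Lam.prems(1) by (cases x) auto
  qed (use Lam.prems(2) in auto)
  moreover have "interp \<sigma> \<theta> A = interp \<sigma>' \<theta>' A"
    by (rule Lam.IH(1)) (use Lam.prems in auto)
  ultimately show ?case by simp
next
  case (Pi A t)
  have "interp (ups \<sigma>) (\<lambda>f. lift (\<theta> f)) t = interp (ups \<sigma>') (\<lambda>f. lift (\<theta>' f)) t"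
  proof (rule Pi.IH(2))
    show "ups \<sigma> x = ups \<sigma>' x" if "x \<in> FV t" for x
      using that Pi.prems(1) by (cases x) auto
  qed (use Pi.prems(2) in auto)
  moreover have "interp \<sigma> \<theta> A = interp \<sigma>' \<theta>' A"
    by (rule Pi.IH(1)) (use Pi.prems in auto)
  ultimately show ?case by simp
next
  case (App t u)
  have "interp \<sigma> \<theta> t = interp \<sigma>' \<theta>' t"
    by (rule App.IH(1)) (use App.prems in auto)
  moreover have "interp \<sigma> \<theta> u = interp \<sigma>' \<theta>' u"
    by (rule App.IH(2)) (use App.prems in auto)
  ultimately show ?case by simp
qed auto

text \<open>Lifting fixes symbols read as themselves, so substitution is the case
  \<open>\<theta> = Fn\<close>, and laws of \<open>interp\<close> specialise to it.\<close>

lemma subst_eq_interp: "subst \<sigma> t = interp \<sigma> Fn t"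
  by (induction t arbitrary: \<sigma>) simp_all

lemma rename_eq_interp: "rename \<rho> t = interp (\<lambda>x. Var (\<rho> x)) Fn t"
proof -
  have *: "ups (\<lambda>x. Var (\<rho> x)) = (\<lambda>x. Var (upr \<rho> x))" for \<rho>
    by (rule ext, rename_tac n, case_tac n) auto
  show ?thesis by (induction t arbitrary: \<rho>) (simp_all add: *)
qed

lemma subst_cong: "(\<And>x. x \<in> FV t \<Longrightarrow> \<sigma> x = \<sigma>' x) \<Longrightarrow> subst \<sigma> t = subst \<sigma>' t"
  unfolding subst_eq_interp by (rule interp_cong) auto

lemma subst_Var [simp]: "subst Var t = t"
proof -
  have *: "ups Var = Var"
    by (rule ext, rename_tac n, case_tac n) auto
  show ?thesis by (induction t) (simp_all add: *)
qed

lemma subst_closed: "FV t = {} \<Longrightarrow> subst \<sigma> t = t"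
  using subst_cong[of t \<sigma> Var] by simp

lemma rename_closed: "FV t = {} \<Longrightarrow> rename \<rho> t = t"
  using subst_closed[of t "\<lambda>x. Var (\<rho> x)"] by (simp add: rename_eq_interp subst_eq_interp)

lemma interp_map_tm: "interp \<sigma> \<theta> (map_tm g t) = interp \<sigma> (\<lambda>f. \<theta> (g f)) t"
  by (induction t arbitrary: \<sigma> \<theta>) simp_all

lemma interp_rename: "interp \<sigma> \<theta> (rename \<rho> t) = interp (\<lambda>x. \<sigma> (\<rho> x)) \<theta> t"
proof -
  have *: "(\<lambda>x. ups \<sigma> (upr \<rho> x)) = ups (\<lambda>x. \<sigma> (\<rho> x))" for \<sigma> :: "nat \<Rightarrow> 'a tm" and \<rho>
    by (rule ext, rename_tac n, case_tac n) auto
  show ?thesis by (induction t arbitrary: \<sigma> \<rho> \<theta>) (simp_all add: *)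
qed

lemma subst_rename: "subst \<sigma> (rename \<rho> t) = subst (\<lambda>x. \<sigma> (\<rho> x)) t"
  by (simp add: subst_eq_interp interp_rename)

lemma rename_interp:
  "rename \<rho> (interp \<sigma> \<theta> t) = interp (\<lambda>x. rename \<rho> (\<sigma> x)) (\<lambda>f. rename \<rho> (\<theta> f)) t"
proof -
  have *: "(\<lambda>x. rename (upr \<rho>) (ups \<sigma> x)) = ups (\<lambda>x. rename \<rho> (\<sigma> x))" for \<rho> and \<sigma> :: "nat \<Rightarrow> 'a tm"
    by (rule ext, rename_tac n, case_tac n) (auto simp: rename_rename)
  show ?thesis by (induction t arbitrary: \<sigma> \<rho> \<theta>) (simp_all add: * rename_rename)
qed

lemma interp_subst: "interp \<sigma> \<theta> (subst \<tau> t) = interp (\<lambda>x. interp \<sigma> \<theta> (\<tau> x)) \<theta> t"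
proof -
  have *: "(\<lambda>x. interp (ups \<sigma>) (\<lambda>f. lift (\<theta> f)) (ups \<tau> x)) = ups (\<lambda>x. interp \<sigma> \<theta> (\<tau> x))"
    for \<tau> and \<sigma> :: "nat \<Rightarrow> 'a tm" and \<theta> :: "'b \<Rightarrow> 'a tm"
    by (rule ext, rename_tac n, case_tac n) (auto simp: interp_rename rename_interp)
  show ?thesis by (induction t arbitrary: \<sigma> \<tau> \<theta>) (simp_all add: *)
qed

lemma subst_interp:
  "subst \<tau> (interp \<sigma> \<theta> t) = interp (\<lambda>x. subst \<tau> (\<sigma> x)) (\<lambda>f. subst \<tau> (\<theta> f)) t"
proof -
  have lift: "subst (ups \<tau>) (lift u) = lift (subst \<tau> u)" for \<tau> and u :: "'a tm"
    by (simp add: subst_eq_interp interp_rename rename_interp)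
  have *: "(\<lambda>x. subst (ups \<tau>) (ups \<sigma> x)) = ups (\<lambda>x. subst \<tau> (\<sigma> x))" for \<tau> and \<sigma> :: "nat \<Rightarrow> 'a tm"
    by (rule ext, rename_tac n, case_tac n) (auto simp: lift)
  show ?thesis by (induction t arbitrary: \<sigma> \<tau> \<theta>) (simp_all add: * lift)
qed

lemma subst_subst: "subst \<tau> (subst \<sigma> t) = subst (\<lambda>x. subst \<tau> (\<sigma> x)) t"
  unfolding subst_eq_interp[of \<sigma> t] by (simp add: subst_interp) (simp add: subst_eq_interp)

lemma rename_subst: "rename \<rho> (subst \<sigma> t) = subst (\<lambda>x. rename \<rho> (\<sigma> x)) t"
  by (simp add: subst_eq_interp rename_interp)

lemma subst_inst_lift [simp]: "subst (inst [u]) (lift t) = t"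
  by (simp add: subst_rename)

text \<open>Both sides send index 0 to the interpreted argument, and instantiation cancels the
  lifting of everything else. This is what carries beta steps and the application rule through an
  interpretation.\<close>

lemma interp_subst_inst:
  "interp \<sigma> \<theta> (subst (inst [u]) t) =
   subst (inst [interp \<sigma> \<theta> u]) (interp (ups \<sigma>) (\<lambda>f. lift (\<theta> f)) t)"
proof -
  have "(\<lambda>x. interp \<sigma> \<theta> (inst [u] x)) = (\<lambda>x. subst (inst [interp \<sigma> \<theta> u]) (ups \<sigma> x))"
    by (rule ext, rename_tac n, case_tac n) auto
  then show ?thesis by (simp add: interp_subst subst_interp)
qed

lemma rename_subst_inst:
  "rename \<rho> (subst (inst [u]) t) = subst (inst [rename \<rho> u]) (rename (upr \<rho>) t)"
proof -
  have "(\<lambda>x. rename \<rho> (inst [u] x)) = (\<lambda>x. inst [rename \<rho> u] (upr \<rho> x))"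
    by (rule ext, rename_tac n, case_tac n) auto
  then show ?thesis by (simp add: rename_subst subst_rename)
qed

text \<open>Passing from the first \<open>k\<close> arguments of a telescope to
  \<open>k + 1\<close>: the innermost binder is filled last.\<close>

lemma subst_inst_ups: "subst (inst [u]) (subst (ups (inst ts)) t) = subst (inst (ts @ [u])) t"
proof -
  have "(\<lambda>x. subst (inst [u]) (ups (inst ts) x)) = inst (ts @ [u])"
    by (rule ext, rename_tac n, case_tac n) auto
  then show ?thesis by (simp add: subst_subst)
qed

text \<open>The bound on the free variables excludes indices beyond the list: these would be lowered
  by \<open>inst\<close> and then changed by \<open>\<sigma>\<close> on the left only.\<close>

lemma subst_subst_inst:
  assumes "FV t \<subseteq> {..<length ts}"
  shows "subst \<sigma> (subst (inst ts) t) = subst (inst (map (subst \<sigma>) ts)) t"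
  unfolding subst_subst by (rule subst_cong) (use assms in \<open>auto simp: inst_map\<close>)

lemma subst_Apps: "subst \<sigma> (Apps f ts) = Apps f (map (subst \<sigma>) ts)"
  by (induction ts rule: rev_induct) simp_all

section \<open>Free variables of substituted terms and of telescopes\<close>

lemma FV_map_tm [simp]: "FV (map_tm g t) = FV t"
  by (induction t) simp_all

lemma FV_rename: "FV (rename \<rho> t) = \<rho> ` FV t"
proof -
  have *: "{x. Suc x \<in> upr \<rho> ` X} = \<rho> ` {x. Suc x \<in> X}" for X \<rho>
  proof (intro set_eqI iffI)
    fix x assume "x \<in> {x. Suc x \<in> upr \<rho> ` X}"
    then obtain y where y: "y \<in> X" "Suc x = upr \<rho> y" by auto
    then show "x \<in> \<rho> ` {x. Suc x \<in> X}" by (cases y) auto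
  qed (force intro: rev_image_eqI)
  show ?thesis by (induction t arbitrary: \<rho>) (auto simp: * image_Un)
qed

lemma FV_subst: "FV (subst \<sigma> t) \<subseteq> (\<Union>x\<in>FV t. FV (\<sigma> x))"
proof -
  \<comment> \<open>Index 0 contributes only itself to \<open>FV (ups \<sigma> 0)\<close>, and the
    binder removes it; the other indices contribute lifted terms.\<close>
  have *: "{x. Suc x \<in> Z} \<subseteq> (\<Union>x\<in>{x. Suc x \<in> X}. FV (\<sigma> x))" if Z: "Z \<subseteq> (\<Union>x\<in>X. FV (ups \<sigma> x))"
    for X Z and \<sigma> :: "nat \<Rightarrow> 'a tm"
  proof
    fix x assume "x \<in> {x. Suc x \<in> Z}"
    then obtain y where y: "y \<in> X" "Suc x \<in> FV (ups \<sigma> y)" using Z by blast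
    then show "x \<in> (\<Union>x\<in>{x. Suc x \<in> X}. FV (\<sigma> x))" by (cases y) (auto simp: FV_rename)
  qed
  show ?thesis
  proof (induction t arbitrary: \<sigma>)
    case (Lam A t)
    show ?case
      unfolding subst.simps FV.simps UN_Un using Lam.IH(1) *[OF Lam.IH(2)] by (rule Un_mono)
  next
    case (Pi A t)
    show ?case
      unfolding subst.simps FV.simps UN_Un using Pi.IH(1) *[OF Pi.IH(2)] by (rule Un_mono)
  next
    case (App t u)
    show ?case
      unfolding subst.simps FV.simps UN_Un using App.IH by (rule Un_mono)
  qed auto
qed

lemma FV_subst_inst: "FV t \<subseteq> {..<length ts} \<Longrightarrow> FV (subst (inst ts) t) \<subseteq> (\<Union>u\<in>set ts. FV u)"
  using FV_subst[of "inst ts" t] inst_mem[of _ ts] by blast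

lemma FV_Apps: "FV (Apps f ts) = (\<Union>t\<in>set ts. FV t)"
  by (induction ts rule: rev_induct) auto

lemma FV_binder_subset: "{x. Suc x \<in> X} \<subseteq> {..<m} \<longleftrightarrow> X \<subseteq> {..<Suc m}"
proof
  assume *: "{x. Suc x \<in> X} \<subseteq> {..<m}"
  show "X \<subseteq> {..<Suc m}"
  proof
    fix x assume "x \<in> X"
    then show "x \<in> {..<Suc m}" using * by (cases x) auto
  qed
qed auto

text \<open>Each product crossed puts one more index in scope, hence the generalisation over
  \<open>m\<close>. For a closed declared type, \<open>m = 0\<close> shows that a domain depends on
  the preceding arguments only.\<close>

lemma FV_Pis_nth: "FV (Pis Ts U) \<subseteq> {..<m} \<Longrightarrow> i < length Ts \<Longrightarrow> FV (Ts ! i) \<subseteq> {..<m + i}"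
proof (induction Ts arbitrary: m i)
  case (Cons T Ts)
  then show ?case
    using Cons.IH[of "Suc m"] by (cases i) (simp_all add: FV_binder_subset)
qed simp

lemma FV_Pis_body: "FV (Pis Ts U) \<subseteq> {..<m} \<Longrightarrow> FV U \<subseteq> {..<m + length Ts}"
proof (induction Ts arbitrary: m)
  case (Cons T Ts)
  then show ?case
    using Cons.IH[of "Suc m"] by (simp add: FV_binder_subset)
qed simp

section \<open>Terms over the symbols of a calculus\<close>

lemma syms_rename [simp]: "syms (rename \<rho> t) = syms t"
  by (induction t arbitrary: \<rho>) auto

lemma terms_simps [simp]:
  "Sort s \<in> terms \<Lambda>" "Var x \<in> terms \<Lambda>" "Fn f \<in> terms \<Lambda> \<longleftrightarrow> f \<in> Funs \<Lambda>"
  "Lam A t \<in> terms \<Lambda> \<longleftrightarrow> A \<in> terms \<Lambda> \<and> t \<in> terms \<Lambda>"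
  "App t u \<in> terms \<Lambda> \<longleftrightarrow> t \<in> terms \<Lambda> \<and> u \<in> terms \<Lambda>"
  "Pi A t \<in> terms \<Lambda> \<longleftrightarrow> A \<in> terms \<Lambda> \<and> t \<in> terms \<Lambda>"
  "rename \<rho> t \<in> terms \<Lambda> \<longleftrightarrow> t \<in> terms \<Lambda>"
  by (auto simp: terms_def)

lemma ups_terms: "(\<And>x. \<sigma> x \<in> terms \<Lambda>) \<Longrightarrow> ups \<sigma> x \<in> terms \<Lambda>"
  by (cases x) auto

lemma interp_terms:
  "t \<in> terms \<Lambda>' \<Longrightarrow> (\<And>x. \<sigma> x \<in> terms \<Lambda>) \<Longrightarrow> (\<And>f. f \<in> Funs \<Lambda>' \<Longrightarrow> \<theta> f \<in> terms \<Lambda>) \<Longrightarrow>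
   interp \<sigma> \<theta> t \<in> terms \<Lambda>"
  by (induction t arbitrary: \<sigma> \<theta>) (simp_all add: ups_terms)

lemma subst_terms: "t \<in> terms \<Lambda> \<Longrightarrow> (\<And>x. \<sigma> x \<in> terms \<Lambda>) \<Longrightarrow> subst \<sigma> t \<in> terms \<Lambda>"
  unfolding subst_eq_interp by (rule interp_terms) auto

lemma inst_terms: "set ts \<subseteq> terms \<Lambda> \<Longrightarrow> inst ts x \<in> terms \<Lambda>"
  by (cases "x < length ts") (use inst_mem[of x ts] in \<open>auto simp: inst_def\<close>)

section \<open>Conversion\<close>

lemma redI: "step (Rules \<Lambda>) t u \<Longrightarrow> t \<in> terms \<Lambda> \<Longrightarrow> u \<in> terms \<Lambda> \<Longrightarrow> red \<Lambda> t u"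
  by (simp add: red_def)

text \<open>Conversion is the least equivalence containing reduction, and the target relation is
  itself an equivalence, so generating steps suffice.\<close>

lemma conv_map:
  assumes "conv \<Lambda>' t u" and "\<And>t u. red \<Lambda>' t u \<Longrightarrow> conv \<Lambda> (h t) (h u)"
  shows "conv \<Lambda> (h t) (h u)"
  using assms(1)
proof (induction rule: equivclp_induct)
  case (step y z)
  then show ?case using assms(2) equivclp_sym equivclp_trans by metis
qed simp

text \<open>The path runs through \<open>Lam A' t\<close>. As \<open>red\<close> relates only terms
  of the calculus, the component held fixed in each half has to be such a term.\<close>

lemma conv_Lam:
  assumes "conv \<Lambda> A A'" and "conv \<Lambda> t t'" and "A' \<in> terms \<Lambda>" and "t \<in> terms \<Lambda>"
  shows "conv \<Lambda> (Lam A t) (Lam A' t')"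
proof -
  have "conv \<Lambda> (Lam A t) (Lam A' t)"
    using assms(1) by (rule conv_map)
      (use assms(4) in \<open>auto simp: red_def intro!: r_into_equivclp step.lam1\<close>)
  moreover have "conv \<Lambda> (Lam A' t) (Lam A' t')"
    using assms(2) by (rule conv_map)
      (use assms(3) in \<open>auto simp: red_def intro!: r_into_equivclp step.lam2\<close>)
  ultimately show ?thesis by (rule equivclp_trans)
qed

lemma conv_App:
  assumes "conv \<Lambda> t t'" and "conv \<Lambda> u u'" and "t' \<in> terms \<Lambda>" and "u \<in> terms \<Lambda>"
  shows "conv \<Lambda> (App t u) (App t' u')"
proof -
  have "conv \<Lambda> (App t u) (App t' u)"
    using assms(1) by (rule conv_map)
      (use assms(4) in \<open>auto simp: red_def intro!: r_into_equivclp step.app1\<close>)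
  moreover have "conv \<Lambda> (App t' u) (App t' u')"
    using assms(2) by (rule conv_map)
      (use assms(3) in \<open>auto simp: red_def intro!: r_into_equivclp step.app2\<close>)
  ultimately show ?thesis by (rule equivclp_trans)
qed

lemma conv_Pi:
  assumes "conv \<Lambda> A A'" and "conv \<Lambda> B B'" and "A' \<in> terms \<Lambda>" and "B \<in> terms \<Lambda>"
  shows "conv \<Lambda> (Pi A B) (Pi A' B')"
proof -
  have "conv \<Lambda> (Pi A B) (Pi A' B)"
    using assms(1) by (rule conv_map)
      (use assms(4) in \<open>auto simp: red_def intro!: r_into_equivclp step.pi1\<close>)
  moreover have "conv \<Lambda> (Pi A' B) (Pi A' B')"
    using assms(2) by (rule conv_map)
      (use assms(3) in \<open>auto simp: red_def intro!: r_into_equivclp step.pi2\<close>)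
  ultimately show ?thesis by (rule equivclp_trans)
qed

text \<open>The quantification over \<open>\<rho>\<close> makes the property stable under passing below a binder.\<close>

definition respects_rules :: "'g calculus \<Rightarrow> 'f calculus \<Rightarrow> ('g \<Rightarrow> 'f tm) \<Rightarrow> bool" where
  "respects_rules \<Lambda>' \<Lambda> \<theta> \<longleftrightarrow>
     (\<forall>f\<in>Funs \<Lambda>'. \<theta> f \<in> terms \<Lambda>) \<and>
     (\<forall>(a, b)\<in>Rules \<Lambda>'. \<forall>\<rho> \<tau>.
        interp \<tau> (\<lambda>f. rename \<rho> (\<theta> f)) a \<in> terms \<Lambda> \<longrightarrow>
        interp \<tau> (\<lambda>f. rename \<rho> (\<theta> f)) b \<in> terms \<Lambda> \<longrightarrow>
        conv \<Lambda> (interp \<tau> (\<lambda>f. rename \<rho> (\<theta> f)) a) (interp \<tau> (\<lambda>f. rename \<rho> (\<theta> f)) b))"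

text \<open>The extra lifting is absorbed by the quantified renaming, as \<open>\<rho>\<close>
  composed with \<open>Suc\<close> is again a renaming.\<close>

lemma respects_rules_lift:
  assumes "respects_rules \<Lambda>' \<Lambda> \<theta>"
  shows "respects_rules \<Lambda>' \<Lambda> (\<lambda>f. lift (\<theta> f))"
  unfolding respects_rules_def rename_rename
proof (intro conjI ballI)
  show "lift (\<theta> f) \<in> terms \<Lambda>" if "f \<in> Funs \<Lambda>'" for f
    using assms that by (auto simp: respects_rules_def)
  fix p assume "p \<in> Rules \<Lambda>'"
  with assms show "case p of (a, b) \<Rightarrow> \<forall>\<rho> \<tau>.
      interp \<tau> (\<lambda>f. rename (\<lambda>n. \<rho> (Suc n)) (\<theta> f)) a \<in> terms \<Lambda> \<longrightarrow>
      interp \<tau> (\<lambda>f. rename (\<lambda>n. \<rho> (Suc n)) (\<theta> f)) b \<in> terms \<Lambda> \<longrightarrow>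
      conv \<Lambda> (interp \<tau> (\<lambda>f. rename (\<lambda>n. \<rho> (Suc n)) (\<theta> f)) a)
        (interp \<tau> (\<lambda>f. rename (\<lambda>n. \<rho> (Suc n)) (\<theta> f)) b)"
    unfolding respects_rules_def by blast
qed

text \<open>The membership premises in \<open>respects_rules\<close> turn an instance of a rule into
  a step of \<open>red\<close>.\<close>

lemma respects_rules_Fn: "respects_rules \<Lambda> \<Lambda> Fn"
  unfolding respects_rules_def
  by (auto simp flip: subst_eq_interp intro!: r_into_equivclp redI step.rule)

lemma interp_respects_terms:
  "respects_rules \<Lambda>' \<Lambda> \<theta> \<Longrightarrow> t \<in> terms \<Lambda>' \<Longrightarrow> (\<And>x. \<sigma> x \<in> terms \<Lambda>) \<Longrightarrow> interp \<sigma> \<theta> t \<in> terms \<Lambda>"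
  unfolding respects_rules_def by (rule interp_terms) blast+

text \<open>Beta steps go to beta steps, but a rule of the source may only hold as a conversion in
  the target, so one step yields a conversion. Both \<open>\<sigma>\<close> and
  \<open>\<theta>\<close> vary, since binders change both.\<close>

lemma step_interp:
  assumes "step (Rules \<Lambda>') t u" and "t \<in> terms \<Lambda>'" and "u \<in> terms \<Lambda>'"
    and "respects_rules \<Lambda>' \<Lambda> \<theta>" and "\<And>x. \<sigma> x \<in> terms \<Lambda>"
  shows "conv \<Lambda> (interp \<sigma> \<theta> t) (interp \<sigma> \<theta> u)"
  using assms
proof (induction arbitrary: \<sigma> \<theta> rule: step.induct)
  case (beta A t u)
  have "red \<Lambda> (interp \<sigma> \<theta> (App (Lam A t) u)) (interp \<sigma> \<theta> (subst (inst [u]) t))"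
  proof (rule redI)
    show "step (Rules \<Lambda>) (interp \<sigma> \<theta> (App (Lam A t) u)) (interp \<sigma> \<theta> (subst (inst [u]) t))"
      unfolding interp_subst_inst interp.simps by (rule step.beta)
  qed (use beta.prems in \<open>auto intro: interp_respects_terms[where \<Lambda>' = \<Lambda>'] simp del: interp.simps\<close>)
  then show ?case by (rule r_into_equivclp)
next
  case (rule l r \<tau>)
  let ?\<tau> = "\<lambda>x. interp \<sigma> \<theta> (\<tau> x)"
  \<comment> \<open>The identity renaming recovers \<open>\<theta>\<close> itself from the
    quantified form of \<open>respects_rules\<close>.\<close>
  have "interp ?\<tau> (\<lambda>f. rename (\<lambda>n. n) (\<theta> f)) l \<in> terms \<Lambda> \<Longrightarrow>
        interp ?\<tau> (\<lambda>f. rename (\<lambda>n. n) (\<theta> f)) r \<in> terms \<Lambda> \<Longrightarrow>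
        conv \<Lambda> (interp ?\<tau> (\<lambda>f. rename (\<lambda>n. n) (\<theta> f)) l)
          (interp ?\<tau> (\<lambda>f. rename (\<lambda>n. n) (\<theta> f)) r)"
    using rule.prems(3) rule.hyps unfolding respects_rules_def by blast
  moreover have "interp \<sigma> \<theta> (subst \<tau> l) \<in> terms \<Lambda>" "interp \<sigma> \<theta> (subst \<tau> r) \<in> terms \<Lambda>"
    using interp_respects_terms rule.prems by blast+
  ultimately show ?case by (simp add: interp_subst)
next
  case (lam1 A A' t)
  have "conv \<Lambda> (interp \<sigma> \<theta> A) (interp \<sigma> \<theta> A')"
    using lam1.prems by (intro lam1.IH) (simp_all add: respects_rules_lift ups_terms)
  then show ?case
    using lam1.prems unfolding interp.simps
    by (intro conv_Lam equivclp_refl interp_respects_terms[where \<Lambda>' = \<Lambda>'])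
      (simp_all add: respects_rules_lift ups_terms)
next
  case (lam2 t t' A)
  have "conv \<Lambda> (interp (ups \<sigma>) (\<lambda>f. lift (\<theta> f)) t) (interp (ups \<sigma>) (\<lambda>f. lift (\<theta> f)) t')"
    using lam2.prems by (intro lam2.IH) (simp_all add: respects_rules_lift ups_terms)
  then show ?case
    using lam2.prems unfolding interp.simps
    by (intro conv_Lam equivclp_refl interp_respects_terms[where \<Lambda>' = \<Lambda>'])
      (simp_all add: respects_rules_lift ups_terms)
next
  case (app1 t t' u)
  have "conv \<Lambda> (interp \<sigma> \<theta> t) (interp \<sigma> \<theta> t')"
    using app1.prems by (intro app1.IH) (simp_all add: respects_rules_lift ups_terms)
  then show ?case
    using app1.prems unfolding interp.simps
    by (intro conv_App equivclp_refl interp_respects_terms[where \<Lambda>' = \<Lambda>'])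
      (simp_all add: respects_rules_lift ups_terms)
next
  case (app2 u u' t)
  have "conv \<Lambda> (interp \<sigma> \<theta> u) (interp \<sigma> \<theta> u')"
    using app2.prems by (intro app2.IH) (simp_all add: respects_rules_lift ups_terms)
  then show ?case
    using app2.prems unfolding interp.simps
    by (intro conv_App equivclp_refl interp_respects_terms[where \<Lambda>' = \<Lambda>'])
      (simp_all add: respects_rules_lift ups_terms)
next
  case (pi1 A A' B)
  have "conv \<Lambda> (interp \<sigma> \<theta> A) (interp \<sigma> \<theta> A')"
    using pi1.prems by (intro pi1.IH) (simp_all add: respects_rules_lift ups_terms)
  then show ?case
    using pi1.prems unfolding interp.simps
    by (intro conv_Pi equivclp_refl interp_respects_terms[where \<Lambda>' = \<Lambda>'])
      (simp_all add: respects_rules_lift ups_terms)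
next
  case (pi2 B B' A)
  have "conv \<Lambda> (interp (ups \<sigma>) (\<lambda>f. lift (\<theta> f)) B) (interp (ups \<sigma>) (\<lambda>f. lift (\<theta> f)) B')"
    using pi2.prems by (intro pi2.IH) (simp_all add: respects_rules_lift ups_terms)
  then show ?case
    using pi2.prems unfolding interp.simps
    by (intro conv_Pi equivclp_refl interp_respects_terms[where \<Lambda>' = \<Lambda>'])
      (simp_all add: respects_rules_lift ups_terms)
qed

lemma conv_interp:
  assumes "conv \<Lambda>' t u" and "respects_rules \<Lambda>' \<Lambda> \<theta>" and "\<And>x. \<sigma> x \<in> terms \<Lambda>"
  shows "conv \<Lambda> (interp \<sigma> \<theta> t) (interp \<sigma> \<theta> u)"
  using assms(1)
proof (rule conv_map)
  fix t u assume "red \<Lambda>' t u"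
  then show "conv \<Lambda> (interp \<sigma> \<theta> t) (interp \<sigma> \<theta> u)"
    by (intro step_interp[OF _ _ _ assms(2,3)]) (simp_all add: red_def)
qed

lemma conv_subst: "conv \<Lambda> t u \<Longrightarrow> (\<And>x. \<sigma> x \<in> terms \<Lambda>) \<Longrightarrow> conv \<Lambda> (subst \<sigma> t) (subst \<sigma> u)"
  unfolding subst_eq_interp by (rule conv_interp[OF _ respects_rules_Fn])

lemma conv_rename: "conv \<Lambda> t u \<Longrightarrow> conv \<Lambda> (rename \<rho> t) (rename \<rho> u)"
  unfolding rename_eq_interp by (rule conv_interp[OF _ respects_rules_Fn]) simp_all

section \<open>Typing\<close>

text \<open>Typability of \<open>Sort Star\<close> serves throughout as the statement that an
  environment is well formed.\<close>

lemma typing_valid: "typing \<Lambda> \<Gamma> t A \<Longrightarrow> typing \<Lambda> \<Gamma> (Sort Star) (Sort Box)"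
proof (induction rule: typing.induct)
  case (var \<Gamma> A s)
  then show ?case using typing.weak[OF var.hyps var.IH] by simp
next
  case (weak \<Gamma> A s b B)
  then show ?case using typing.weak[OF weak.hyps(1) weak.IH(1)] by simp
qed (auto intro: typing.ax)

lemma typing_Cons_valid: "typing \<Lambda> \<Delta> t A \<Longrightarrow> \<Delta> = X # \<Gamma> \<Longrightarrow> \<exists>s. typing \<Lambda> \<Gamma> X (Sort s)"
  by (induction rule: typing.induct) auto

lemma valid_Cons:
  assumes "typing \<Lambda> \<Gamma> X (Sort s)"
  shows "typing \<Lambda> (X # \<Gamma>) (Sort Star) (Sort Box)"
  using typing.weak[OF assms typing_valid[OF assms]] by simp

text \<open>Proved ahead of full inversion: the interpretation lemma already needs the domain,
  whereas the codomain calls for weakening below a binder, which is obtained from that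
  lemma.\<close>

lemma typing_Pi_domain: "typing \<Lambda> \<Gamma> (Pi A B) C \<Longrightarrow> typing \<Lambda> \<Gamma> A (Sort Star)"
proof (induction \<Gamma> "Pi A B" C arbitrary: A B rule: typing.induct)
  case (weak \<Gamma> X s b C)
  from weak.hyps(5) obtain A' B' where "b = Pi A' B'" "A = lift A'" by (cases b) auto
  then show ?case using typing.weak[OF weak.hyps(1) weak.hyps(4)] by simp
qed auto

lemma typing_FV: "typing \<Lambda> \<Gamma> t A \<Longrightarrow> FV t \<subseteq> {..<length \<Gamma>} \<and> FV A \<subseteq> {..<length \<Gamma>}"
proof (induction rule: typing.induct)
  case (app \<Gamma> t A B a)
  have "FV (inst [a] x) \<subseteq> {..<length \<Gamma>}" if "x \<in> FV B" for x
    using that app.IH by (cases x) (auto simp: FV_binder_subset)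
  then have "FV (subst (inst [a]) B) \<subseteq> {..<length \<Gamma>}" using FV_subst[of "inst [a]" B] by blast
  with app.IH show ?case by simp
qed (auto simp: FV_rename FV_binder_subset)

lemma typing_terms:
  assumes "calculus_modulo \<Lambda>" and "typing \<Lambda> \<Gamma> t A"
  shows "t \<in> terms \<Lambda> \<and> A \<in> terms \<Lambda>"
  using assms(2)
proof (induction rule: typing.induct)
  case (app \<Gamma> t A B a)
  then show ?case by (auto intro!: subst_terms inst_terms)
qed (use assms(1) in \<open>auto simp: calculus_modulo_def\<close>)

text \<open>A judgement in the empty environment is closed, so the lifting done by the weakening
  rule leaves it unchanged.\<close>

lemma typing_weaken_closed:
  assumes "typing \<Lambda> [] t A" and "typing \<Lambda> \<Gamma> (Sort Star) (Sort Box)"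
  shows "typing \<Lambda> \<Gamma> t A"
  using assms(2)
proof (induction \<Gamma>)
  case (Cons X \<Gamma>)
  then obtain s where s: "typing \<Lambda> \<Gamma> X (Sort s)" using typing_Cons_valid by blast
  have "typing \<Lambda> (X # \<Gamma>) (lift t) (lift A)"
    using typing.weak[OF s Cons.IH[OF typing_valid[OF s]]] .
  then show ?case using typing_FV[OF assms(1)] by (simp add: rename_closed)
qed (use assms in simp)

text \<open>Induction on the derivation, with the interpretation and the target environment
  generalised. The type of index \<open>i\<close> is written in the part of \<open>\<Gamma>\<close>
  beyond \<open>i\<close>, hence the shift by \<open>Suc i\<close>. Since declared types are closed,
  the typing of \<open>\<theta> f\<close> can be stated with \<open>Var\<close> and used under every
  \<open>\<sigma>\<close>.\<close>

lemma typing_interp: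
  assumes "typing \<Lambda>' \<Gamma> t A"
    and "\<And>f. f \<in> Funs \<Lambda>' \<Longrightarrow> FV (Typ \<Lambda>' f) = {}"
    and "typing \<Lambda> \<Delta> (Sort Star) (Sort Box)"
    and "respects_rules \<Lambda>' \<Lambda> \<theta>"
    and "\<And>f. f \<in> Funs \<Lambda>' \<Longrightarrow> typing \<Lambda> \<Delta> (\<theta> f) (interp Var \<theta> (Typ \<Lambda>' f))"
    and "\<And>x. \<sigma> x \<in> terms \<Lambda>"
    and "\<And>i. i < length \<Gamma> \<Longrightarrow>
           typing \<Lambda> \<Delta> (\<sigma> i) (interp \<sigma> \<theta> (rename (\<lambda>n. n + Suc i) (\<Gamma> ! i)))"
  shows "typing \<Lambda> \<Delta> (interp \<sigma> \<theta> t) (interp \<sigma> \<theta> A)"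
proof -
  \<comment> \<open>The passage below a binder is shared by the product and abstraction cases; the
    induction hypothesis for the body enters as a premise.\<close>
  have under_binder:
    "typing \<Lambda> (interp \<sigma> \<theta> A # \<Delta>) (interp (ups \<sigma>) (\<lambda>f. lift (\<theta> f)) b)
        (interp (ups \<sigma>) (\<lambda>f. lift (\<theta> f)) B)"
    if IH: "\<And>\<Delta> \<sigma> \<theta>. typing \<Lambda> \<Delta> (Sort Star) (Sort Box) \<Longrightarrow> respects_rules \<Lambda>' \<Lambda> \<theta> \<Longrightarrow>
      (\<And>f. f \<in> Funs \<Lambda>' \<Longrightarrow> typing \<Lambda> \<Delta> (\<theta> f) (interp Var \<theta> (Typ \<Lambda>' f))) \<Longrightarrow>
      (\<And>x. \<sigma> x \<in> terms \<Lambda>) \<Longrightarrow>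
      (\<And>i. i < length (A # \<Gamma>) \<Longrightarrow>
        typing \<Lambda> \<Delta> (\<sigma> i) (interp \<sigma> \<theta> (rename (\<lambda>n. n + Suc i) ((A # \<Gamma>) ! i)))) \<Longrightarrow>
      typing \<Lambda> \<Delta> (interp \<sigma> \<theta> b) (interp \<sigma> \<theta> B)"
    and A: "typing \<Lambda> \<Delta> (interp \<sigma> \<theta> A) (Sort s)"
    and resp: "respects_rules \<Lambda>' \<Lambda> \<theta>"
    and funs: "\<And>f. f \<in> Funs \<Lambda>' \<Longrightarrow> typing \<Lambda> \<Delta> (\<theta> f) (interp Var \<theta> (Typ \<Lambda>' f))"
    and tm: "\<And>x. \<sigma> x \<in> terms \<Lambda>"
    and vars: "\<And>i. i < length \<Gamma> \<Longrightarrow>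
      typing \<Lambda> \<Delta> (\<sigma> i) (interp \<sigma> \<theta> (rename (\<lambda>n. n + Suc i) (\<Gamma> ! i)))"
    for \<Delta> \<sigma> \<theta> \<Gamma> A b B s
  proof (rule IH)
    show "typing \<Lambda> (interp \<sigma> \<theta> A # \<Delta>) (Sort Star) (Sort Box)"
      using A by (rule valid_Cons)
    show "respects_rules \<Lambda>' \<Lambda> (\<lambda>f. lift (\<theta> f))"
      using resp by (rule respects_rules_lift)
    show "typing \<Lambda> (interp \<sigma> \<theta> A # \<Delta>) (lift (\<theta> f)) (interp Var (\<lambda>f. lift (\<theta> f)) (Typ \<Lambda>' f))"
      if f: "f \<in> Funs \<Lambda>'" for f
    proof -
      \<comment> \<open>Lifting also turns the assignment \<open>Var\<close> into a shifted one,
        which is harmless because the declared type is closed.\<close>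
      have "lift (interp Var \<theta> (Typ \<Lambda>' f)) = interp Var (\<lambda>f. lift (\<theta> f)) (Typ \<Lambda>' f)"
        unfolding rename_interp by (rule interp_cong) (simp_all add: assms(2)[OF f])
      then show ?thesis using typing.weak[OF A funs[OF f]] by simp
    qed
    show "ups \<sigma> x \<in> terms \<Lambda>" for x using tm by (rule ups_terms)
    fix i assume i: "i < length (A # \<Gamma>)"
    show "typing \<Lambda> (interp \<sigma> \<theta> A # \<Delta>) (ups \<sigma> i)
      (interp (ups \<sigma>) (\<lambda>f. lift (\<theta> f)) (rename (\<lambda>n. n + Suc i) ((A # \<Gamma>) ! i)))"
    proof (cases i)
      case 0
      then show ?thesis using typing.var[OF A] by (simp add: interp_rename rename_interp)
    next
      case (Suc j)
      then show ?thesis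
        using i typing.weak[OF A vars[of j]] by (simp add: interp_rename rename_interp)
    qed
  qed
  show ?thesis
    using assms(1,3-)
  proof (induction arbitrary: \<Delta> \<sigma> \<theta> rule: typing.induct)
    case ax
    then show ?case by simp
  next
    case ("fun" f)
    have "interp \<sigma> \<theta> (Typ \<Lambda>' f) = interp Var \<theta> (Typ \<Lambda>' f)"
      by (rule interp_cong) (simp_all add: assms(2)[OF fun.hyps(1)])
    with fun.prems(3)[OF fun.hyps(1)] show ?case by simp
  next
    case (var \<Gamma> A s)
    then show ?case using var.prems(5)[of 0] by simp
  next
    case (weak \<Gamma> A s b B)
    \<comment> \<open>A weakened judgement does not mention the newest variable, so the value of
      \<open>\<sigma>\<close> at 0 is dropped.\<close>
    have "typing \<Lambda> \<Delta> (interp (\<lambda>x. \<sigma> (Suc x)) \<theta> b) (interp (\<lambda>x. \<sigma> (Suc x)) \<theta> B)"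
    proof (rule weak.IH(2))
      fix i assume "i < length \<Gamma>"
      then show "typing \<Lambda> \<Delta> (\<sigma> (Suc i))
        (interp (\<lambda>x. \<sigma> (Suc x)) \<theta> (rename (\<lambda>n. n + Suc i) (\<Gamma> ! i)))"
        using weak.prems(5)[of "Suc i"] by (simp add: interp_rename)
    qed (use weak.prems in auto)
    then show ?case by (simp add: interp_rename)
  next
    case (prod \<Gamma> A B s)
    have A: "typing \<Lambda> \<Delta> (interp \<sigma> \<theta> A) (Sort Star)"
      using prod.IH(1)[OF prod.prems] by simp
    have "typing \<Lambda> (interp \<sigma> \<theta> A # \<Delta>) (interp (ups \<sigma>) (\<lambda>f. lift (\<theta> f)) B) (Sort s)"
      using under_binder[OF prod.IH(2) A prod.prems(2-)] unfolding interp.simps .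
    with A show ?case unfolding interp.simps by (rule typing.prod)
  next
    case (app \<Gamma> t A B a)
    show ?case
      unfolding interp_subst_inst
      using typing.app[OF app.IH(1)[OF app.prems, simplified] app.IH(2)[OF app.prems]] by simp
  next
    case (abs A \<Gamma> b B s)
    have P: "typing \<Lambda> \<Delta> (interp \<sigma> \<theta> (Pi A B)) (Sort s)"
      using abs.IH(2)[OF abs.prems] by simp
    \<comment> \<open>The abstraction rule types the product only; the domain is needed to extend
      the target environment.\<close>
    then have A: "typing \<Lambda> \<Delta> (interp \<sigma> \<theta> A) (Sort Star)" by (simp add: typing_Pi_domain)
    have "typing \<Lambda> (interp \<sigma> \<theta> A # \<Delta>) (interp (ups \<sigma>) (\<lambda>f. lift (\<theta> f)) b)
        (interp (ups \<sigma>) (\<lambda>f. lift (\<theta> f)) B)"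
      using under_binder[OF abs.IH(1) A abs.prems(2-)] .
    then show ?case using P unfolding interp.simps by (rule typing.abs)
  next
    case (conv \<Gamma> a A B s)
    have "conv \<Lambda> (interp \<sigma> \<theta> A) (interp \<sigma> \<theta> B)"
      using conv.hyps(2) conv.prems(2,4) by (rule conv_interp)
    then show ?case
      using typing.conv[OF conv.IH(1)[OF conv.prems]] conv.IH(2)[OF conv.prems] by simp
  qed
qed

section \<open>Substitution and inversion of typing under the standing assumptions\<close>

locale confluent_calculus =
  fixes \<Lambda> :: "'f calculus"
  assumes modulo: "calculus_modulo \<Lambda>"
    and typing_Typ: "f \<in> Funs \<Lambda> \<Longrightarrow> typing \<Lambda> [] (Typ \<Lambda> f) (Sort (Srt \<Lambda> f))"
    and confluent: "confluentp (red \<Lambda>)"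
    and lhs_Apps: "(l, r) \<in> Rules \<Lambda> \<Longrightarrow> \<exists>f ts. l = Apps f ts"
begin

lemma Typ_closed: "f \<in> Funs \<Lambda> \<Longrightarrow> FV (Typ \<Lambda> f) = {}"
  using typing_FV[OF typing_Typ] by simp

lemma typing_subst:
  assumes "typing \<Lambda> \<Gamma> t A" and "typing \<Lambda> \<Delta> (Sort Star) (Sort Box)" and "\<And>x. \<sigma> x \<in> terms \<Lambda>"
    and "\<And>i. i < length \<Gamma> \<Longrightarrow>
           typing \<Lambda> \<Delta> (\<sigma> i) (subst \<sigma> (rename (\<lambda>n. n + Suc i) (\<Gamma> ! i)))"
  shows "typing \<Lambda> \<Delta> (subst \<sigma> t) (subst \<sigma> A)"
  unfolding subst_eq_interp
proof (rule typing_interp[OF assms(1) Typ_closed assms(2) respects_rules_Fn _ assms(3)])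
  show "typing \<Lambda> \<Delta> (Fn f) (interp Var Fn (Typ \<Lambda> f))" if "f \<in> Funs \<Lambda>" for f
    using typing_weaken_closed[OF typing.fun[OF that typing_Typ[OF that]] assms(2)]
    by (simp flip: subst_eq_interp)
qed (use assms(4) in \<open>simp_all flip: subst_eq_interp\<close>)

lemma typing_Var:
  "typing \<Lambda> \<Gamma> (Sort Star) (Sort Box) \<Longrightarrow> i < length \<Gamma> \<Longrightarrow>
   typing \<Lambda> \<Gamma> (Var i) (rename (\<lambda>n. n + Suc i) (\<Gamma> ! i))"
proof (induction \<Gamma> arbitrary: i)
  case (Cons X \<Gamma>)
  then obtain s where s: "typing \<Lambda> \<Gamma> X (Sort s)" using typing_Cons_valid by blast
  show ?case
  proof (cases i)
    case 0
    then show ?thesis using typing.var[OF s] by simp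
  next
    case (Suc j)
    then show ?thesis
      using typing.weak[OF s Cons.IH[OF typing_valid[OF s], of j]] Cons.prems(2)
      by (simp add: rename_rename)
  qed
qed simp

lemma typing_subst_inst:
  assumes "typing \<Lambda> (X # \<Gamma>) t A" and "typing \<Lambda> \<Gamma> a X"
  shows "typing \<Lambda> \<Gamma> (subst (inst [a]) t) (subst (inst [a]) A)"
proof (rule typing_subst[OF assms(1) typing_valid[OF assms(2)]])
  show "inst [a] x \<in> terms \<Lambda>" for x
    using typing_terms[OF modulo assms(2)] by (intro inst_terms) simp
  \<comment> \<open>Index 0 becomes \<open>a\<close>; every other index moves down by one, hence
    \<open>i - 1\<close>.\<close>
  fix i assume "i < length (X # \<Gamma>)"
  then show "typing \<Lambda> \<Gamma> (inst [a] i) (subst (inst [a]) (rename (\<lambda>n. n + Suc i) ((X # \<Gamma>) ! i)))"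
    using assms(2) typing_Var[OF typing_valid[OF assms(2)], of "i - 1"]
    by (cases i) (simp_all add: subst_rename, simp add: subst_eq_interp rename_eq_interp)
qed

text \<open>The new declaration is inserted just below the head, so index 0 must stay fixed and the
  renaming is \<open>upr Suc\<close>. It is treated as a substitution by variables.\<close>

lemma typing_weaken_under_binder:
  assumes "typing \<Lambda> (A # \<Gamma>) t B" and "typing \<Lambda> \<Gamma> X (Sort s)"
  shows "typing \<Lambda> (lift A # X # \<Gamma>) (rename (upr Suc) t) (rename (upr Suc) B)"
proof -
  obtain s' where "typing \<Lambda> \<Gamma> A (Sort s')" using typing_Cons_valid[OF assms(1)] by blast
  from typing.weak[OF assms(2) this]
  have valid: "typing \<Lambda> (lift A # X # \<Gamma>) (Sort Star) (Sort Box)"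
    by (intro valid_Cons) simp
  have "typing \<Lambda> (lift A # X # \<Gamma>) (subst (\<lambda>x. Var (upr Suc x)) t) (subst (\<lambda>x. Var (upr Suc x)) B)"
  proof (rule typing_subst[OF assms(1) valid])
    fix i assume i: "i < length (A # \<Gamma>)"
    have "subst (\<lambda>x. Var (upr Suc x)) (rename (\<lambda>n. n + Suc i) ((A # \<Gamma>) ! i)) =
      rename (\<lambda>n. n + Suc (upr Suc i)) ((lift A # X # \<Gamma>) ! upr Suc i)"
      by (cases i) (simp_all add: subst_eq_interp rename_eq_interp[symmetric] rename_rename)
    then show "typing \<Lambda> (lift A # X # \<Gamma>) (Var (upr Suc i))
        (subst (\<lambda>x. Var (upr Suc x)) (rename (\<lambda>n. n + Suc i) ((A # \<Gamma>) ! i)))"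
      using typing_Var[OF valid, of "upr Suc i"] i by (cases i) simp_all
  qed simp
  then show ?thesis by (simp add: rename_eq_interp subst_eq_interp)
qed

text \<open>Conversion and weakening are the only rules not directed by the term. Conversion is
  absorbed by stating the type up to \<open>conv\<close>, and weakening is pushed into the premises
  by a case split on the term.\<close>

lemma typing_generation:
  "typing \<Lambda> \<Gamma> t C \<Longrightarrow>
   (case t of
      Sort s \<Rightarrow> conv \<Lambda> C (Sort Box)
    | Var x \<Rightarrow> conv \<Lambda> C (rename (\<lambda>n. n + Suc x) (\<Gamma> ! x))
    | Fn f \<Rightarrow> f \<in> Funs \<Lambda> \<and> conv \<Lambda> C (Typ \<Lambda> f)
    | Lam A b \<Rightarrow> \<exists>B. typing \<Lambda> (A # \<Gamma>) b B \<and> conv \<Lambda> C (Pi A B)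
    | App u a \<Rightarrow> \<exists>A B. typing \<Lambda> \<Gamma> u (Pi A B) \<and> typing \<Lambda> \<Gamma> a A \<and> conv \<Lambda> C (subst (inst [a]) B)
    | Pi A B \<Rightarrow> \<exists>s. typing \<Lambda> \<Gamma> A (Sort Star) \<and> typing \<Lambda> (A # \<Gamma>) B (Sort s) \<and> conv \<Lambda> C (Sort s))"
proof (induction rule: typing.induct)
  case (weak \<Gamma> X s b C)
  note lift = conv_rename[where \<rho> = Suc] typing.weak[OF weak.hyps(1)]
  note IH = weak.IH(2)
  show ?case
  proof (cases b)
    case (Sort s)
    then show ?thesis using lift(1)[of _ C "Sort Box"] IH by simp
  next
    case (Var x)
    then show ?thesis
      using lift(1)[of _ C "rename (\<lambda>n. n + Suc x) (\<Gamma> ! x)"] IH by (simp add: rename_rename)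
  next
    case (Fn f)
    then show ?thesis
      using lift(1)[of _ C "Typ \<Lambda> f"] IH by (simp add: rename_closed Typ_closed)
  next
    case (Lam A b')
    then obtain B where B: "typing \<Lambda> (A # \<Gamma>) b' B" "conv \<Lambda> C (Pi A B)" using IH by auto
    show ?thesis
      using typing_weaken_under_binder[OF B(1) weak.hyps(1)] lift(1)[OF B(2)] Lam by auto
  next
    case (App u a)
    then obtain A B where B: "typing \<Lambda> \<Gamma> u (Pi A B)" "typing \<Lambda> \<Gamma> a A"
        "conv \<Lambda> C (subst (inst [a]) B)"
      using IH by auto
    have "typing \<Lambda> (X # \<Gamma>) (lift u) (Pi (lift A) (rename (upr Suc) B))" using lift(2)[OF B(1)] by simp
    moreover have "typing \<Lambda> (X # \<Gamma>) (lift a) (lift A)" using lift(2)[OF B(2)] .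
    moreover have "conv \<Lambda> (lift C) (subst (inst [lift a]) (rename (upr Suc) B))"
      using lift(1)[OF B(3)] by (simp add: rename_subst_inst)
    ultimately show ?thesis using App by auto
  next
    case (Pi A B)
    then obtain s' where B: "typing \<Lambda> \<Gamma> A (Sort Star)" "typing \<Lambda> (A # \<Gamma>) B (Sort s')" "conv \<Lambda> C (Sort s')"
      using IH by auto
    show ?thesis
      using typing_weaken_under_binder[OF B(2) weak.hyps(1)] lift(1)[OF B(3)] lift(2)[OF B(1)] Pi
      by auto
  qed
next
  case (conv \<Gamma> a A B s)
  have *: "conv \<Lambda> B X" if "conv \<Lambda> A X" for X
    using equivclp_trans[OF equivclp_sym[OF conv.hyps(2)] that] .
  show ?case
    using conv.IH(1) by (cases a) (auto intro: *)
next
  case (app \<Gamma> t A B a)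
  show ?case unfolding tm.case using app.hyps equivclp_refl by fast
qed auto

lemma typing_AppE:
  assumes "typing \<Lambda> \<Gamma> (App t a) C"
  obtains A B where "typing \<Lambda> \<Gamma> t (Pi A B)" "typing \<Lambda> \<Gamma> a A" "conv \<Lambda> C (subst (inst [a]) B)"
  using typing_generation[OF assms] by auto

section \<open>Injectivity of products and uniqueness of types\<close>

lemma red_Pi: "red \<Lambda> (Pi A B) t \<Longrightarrow> \<exists>A' B'. t = Pi A' B' \<and> (red \<Lambda>)\<^sup>*\<^sup>* A A' \<and> (red \<Lambda>)\<^sup>*\<^sup>* B B'"
proof -
  assume red: "red \<Lambda> (Pi A B) t"
  then have "step (Rules \<Lambda>) (Pi A B) t" by (simp add: red_def)
  then show ?thesis
  proof cases
    case (rule l r \<sigma>)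
    \<comment> \<open>An instance of a term headed by a symbol is headed by that symbol, so no rule
      applies at the root of a product.\<close>
    obtain f ts where "l = Apps f ts" using lhs_Apps[OF rule(3)] by blast
    with rule(1) show ?thesis by (cases ts rule: rev_cases) auto
  qed (use red in \<open>auto simp: red_def\<close>)
qed

lemma reds_Pi:
  "(red \<Lambda>)\<^sup>*\<^sup>* (Pi A B) t \<Longrightarrow> \<exists>A' B'. t = Pi A' B' \<and> (red \<Lambda>)\<^sup>*\<^sup>* A A' \<and> (red \<Lambda>)\<^sup>*\<^sup>* B B'"
proof (induction rule: rtranclp_induct)
  case (step y z)
  then obtain A' B' where y: "y = Pi A' B'" "(red \<Lambda>)\<^sup>*\<^sup>* A A'" "(red \<Lambda>)\<^sup>*\<^sup>* B B'" by blast
  then obtain A'' B'' where "z = Pi A'' B''" "(red \<Lambda>)\<^sup>*\<^sup>* A' A''" "(red \<Lambda>)\<^sup>*\<^sup>* B' B''"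
    using red_Pi step.hyps(2) by blast
  with y show ?case using rtranclp_trans[of "red \<Lambda>"] by blast
qed auto

lemma conv_common_reduct: "conv \<Lambda> t u \<Longrightarrow> \<exists>v. (red \<Lambda>)\<^sup>*\<^sup>* t v \<and> (red \<Lambda>)\<^sup>*\<^sup>* u v"
  using semiconfluentp_equivclp[OF confluentp_imp_semiconfluentp[OF confluent]]
  by (auto simp: rtranclp_conversep relcompp_apply)

text \<open>Reducts of a product are products reduced componentwise, so a common reduct of the two
  products supplies common reducts of their components.\<close>

lemma conv_Pi_inject:
  assumes "conv \<Lambda> (Pi A B) (Pi A' B')"
  shows "conv \<Lambda> A A'" and "conv \<Lambda> B B'"
proof -
  obtain v where v: "(red \<Lambda>)\<^sup>*\<^sup>* (Pi A B) v" "(red \<Lambda>)\<^sup>*\<^sup>* (Pi A' B') v"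
    using conv_common_reduct[OF assms] by blast
  obtain X Y where XY: "v = Pi X Y" "(red \<Lambda>)\<^sup>*\<^sup>* A X" "(red \<Lambda>)\<^sup>*\<^sup>* B Y" using reds_Pi[OF v(1)] by blast
  then have "(red \<Lambda>)\<^sup>*\<^sup>* A' X" "(red \<Lambda>)\<^sup>*\<^sup>* B' Y" using reds_Pi[OF v(2)] by auto
  with XY show "conv \<Lambda> A A'" "conv \<Lambda> B B'"
    by (meson equivclp_trans rtranclp_into_equivclp converse_rtranclp_into_equivclp)+
qed

text \<open>Inversion determines a type up to conversion from the types of the subterms. For
  applications, the two product types of the function are convertible, and injectivity gives
  convertible codomains.\<close>

lemma typing_unique: "typing \<Lambda> \<Gamma> t A \<Longrightarrow> typing \<Lambda> \<Gamma> t B \<Longrightarrow> conv \<Lambda> A B"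
proof (induction t arbitrary: \<Gamma> A B)
  case (Lam X b)
  obtain C where C: "typing \<Lambda> (X # \<Gamma>) b C" "conv \<Lambda> A (Pi X C)"
    using typing_generation[OF Lam.prems(1)] by auto
  obtain D where D: "typing \<Lambda> (X # \<Gamma>) b D" "conv \<Lambda> B (Pi X D)"
    using typing_generation[OF Lam.prems(2)] by auto
  have "conv \<Lambda> (Pi X C) (Pi X D)"
    using Lam.IH(2)[OF C(1) D(1)] typing_terms[OF modulo C(1)] typing_terms[OF modulo Lam.prems(1)]
    by (intro conv_Pi) auto
  with C D show ?case by (meson equivclp_sym equivclp_trans)
next
  case (App t a)
  obtain X C where C: "typing \<Lambda> \<Gamma> t (Pi X C)" "conv \<Lambda> A (subst (inst [a]) C)"
    using App.prems(1) by (rule typing_AppE)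
  obtain Y D where D: "typing \<Lambda> \<Gamma> t (Pi Y D)" "conv \<Lambda> B (subst (inst [a]) D)"
    using App.prems(2) by (rule typing_AppE)
  have "conv \<Lambda> C D" using App.IH(1)[OF C(1) D(1)] by (rule conv_Pi_inject)
  then have "conv \<Lambda> (subst (inst [a]) C) (subst (inst [a]) D)"
    using typing_terms[OF modulo App.prems(1)] by (intro conv_subst inst_terms) auto
  with C D show ?case by (meson equivclp_sym equivclp_trans)
next
  case (Pi X Y)
  obtain s where C: "typing \<Lambda> (X # \<Gamma>) Y (Sort s)" "conv \<Lambda> A (Sort s)"
    using typing_generation[OF Pi.prems(1)] by auto
  obtain s' where D: "typing \<Lambda> (X # \<Gamma>) Y (Sort s')" "conv \<Lambda> B (Sort s')"
    using typing_generation[OF Pi.prems(2)] by auto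
  show ?case using Pi.IH(2)[OF C(1) D(1)] C D by (meson equivclp_sym equivclp_trans)
next
  case (Sort s)
  show ?case
    using typing_generation[OF Sort(1)] typing_generation[OF Sort(2)]
    by (auto intro: equivclp_sym equivclp_trans)
next
  case (Var s)
  show ?case
    using typing_generation[OF Var(1)] typing_generation[OF Var(2)]
    by (auto intro: equivclp_sym equivclp_trans)
next
  case (Fn s)
  show ?case
    using typing_generation[OF Fn(1)] typing_generation[OF Fn(2)]
    by (auto intro: equivclp_sym equivclp_trans)
qed

section \<open>Sorts of types, and inversion along an applied symbol\<close>

lemma typing_Pi_codomain:
  assumes "typing \<Lambda> \<Gamma> (Pi A B) (Sort s)"
  shows "\<exists>s. typing \<Lambda> (A # \<Gamma>) B (Sort s)"
  using typing_generation[OF assms] by auto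

text \<open>The exception arises from the axiom and from products of sort \<open>Box\<close>. An
  application avoids it: the type of its function is a product, hence not \<open>Box\<close>, hence
  typable, and so is the instantiated codomain.\<close>

lemma typing_type:
  "typing \<Lambda> \<Gamma> t A \<Longrightarrow>
   (\<exists>s. typing \<Lambda> \<Gamma> A (Sort s)) \<or> A = Sort Box \<and> (t = Sort Star \<or> (\<exists>X Y. t = Pi X Y))"
proof (induction rule: typing.induct)
  case (var \<Gamma> A s)
  then show ?case using typing.weak[OF var.hyps var.hyps] by auto
next
  case (weak \<Gamma> A s b B)
  from weak.IH(2) show ?case
  proof
    assume "\<exists>s. typing \<Lambda> \<Gamma> B (Sort s)"
    then obtain s' where "typing \<Lambda> \<Gamma> B (Sort s')" by blast
    from typing.weak[OF weak.hyps(1) this] show ?thesis by auto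
  qed auto
next
  case (prod \<Gamma> A B s)
  then show ?case using typing_valid[OF prod.hyps(1)] by (cases s) auto
next
  case (app \<Gamma> t A B a)
  then have "\<exists>s. typing \<Lambda> (A # \<Gamma>) B (Sort s)" using typing_Pi_codomain by auto
  then show ?case using typing_subst_inst[OF _ app.hyps(2)] by fastforce
qed auto

text \<open>Inversion peels off one argument at a time, and injectivity of products compares the
  type found with the declared telescope. Each expected argument type has sort \<open>Star\<close>
  because it is the domain of a typable product.\<close>

lemma typing_Apps:
  assumes "typing \<Lambda> \<Gamma> (Apps f ts) A" and "Typ \<Lambda> f = Pis Ts U" and "length ts = length Ts"
  shows "i < length Ts \<Longrightarrow> typing \<Lambda> \<Gamma> (ts ! i) (subst (inst (take i ts)) (Ts ! i))"
    and "i < length Ts \<Longrightarrow> typing \<Lambda> \<Gamma> (subst (inst (take i ts)) (Ts ! i)) (Sort Star)"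
    and "conv \<Lambda> A (subst (inst ts) U)"
proof -
  \<comment> \<open>The type that the declaration assigns to \<open>f\<close> applied to its first
    \<open>k\<close> arguments.\<close>
  let ?B = "\<lambda>k. subst (inst (take k ts)) (Pis (drop k Ts) U)"
  \<comment> \<open>The type \<open>A\<close> is generalised, since each prefix of the application
    has its own. Typability of \<open>?B k\<close> is carried along to obtain the sort of the next
    domain.\<close>
  have *: "(\<forall>i<k. typing \<Lambda> \<Gamma> (ts ! i) (subst (inst (take i ts)) (Ts ! i)) \<and>
                 typing \<Lambda> \<Gamma> (subst (inst (take i ts)) (Ts ! i)) (Sort Star)) \<and>
    conv \<Lambda> A (?B k) \<and> (\<exists>s. typing \<Lambda> \<Gamma> (?B k) (Sort s))"
    if "k \<le> length Ts" "typing \<Lambda> \<Gamma> (Apps f (take k ts)) A" for k A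
    using that
  proof (induction k arbitrary: A)
    case 0
    then have "f \<in> Funs \<Lambda>" "conv \<Lambda> A (Typ \<Lambda> f)" using typing_generation[of \<Gamma> "Fn f"] by auto
    then show ?case
      using typing_weaken_closed[OF typing_Typ typing_valid[OF 0(2)], of f] assms(2) by auto
  next
    case (Suc k)
    then have k: "k < length Ts" "k < length ts" using assms(3) by simp_all
    let ?T = "subst (inst (take k ts)) (Ts ! k)"
    let ?R = "subst (ups (inst (take k ts))) (Pis (drop (Suc k) Ts) U)"
    have Bk: "?B k = Pi ?T ?R" by (simp add: Cons_nth_drop_Suc[OF k(1), symmetric])
    have BSuc: "?B (Suc k) = subst (inst [ts ! k]) ?R"
      by (simp add: subst_inst_ups take_Suc_conv_app_nth[OF k(2)])
    have "typing \<Lambda> \<Gamma> (App (Apps f (take k ts)) (ts ! k)) A"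
      using Suc.prems(2) by (simp add: take_Suc_conv_app_nth[OF k(2)])
    then obtain X Y where XY: "typing \<Lambda> \<Gamma> (Apps f (take k ts)) (Pi X Y)" "typing \<Lambda> \<Gamma> (ts ! k) X"
        "conv \<Lambda> A (subst (inst [ts ! k]) Y)"
      by (rule typing_AppE)
    note IH = Suc.IH[OF less_imp_le[OF k(1)] XY(1)]
    then obtain s where s: "typing \<Lambda> \<Gamma> (Pi ?T ?R) (Sort s)" unfolding Bk by blast
    have T: "typing \<Lambda> \<Gamma> ?T (Sort Star)" using s by (rule typing_Pi_domain)
    have conv: "conv \<Lambda> (Pi X Y) (Pi ?T ?R)" using IH unfolding Bk by blast
    have t: "typing \<Lambda> \<Gamma> (ts ! k) ?T"
      using XY(2) conv_Pi_inject(1)[OF conv] T by (rule typing.conv)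
    have "conv \<Lambda> (subst (inst [ts ! k]) Y) (?B (Suc k))"
      unfolding BSuc using conv_Pi_inject(2)[OF conv] typing_terms[OF modulo XY(2)]
      by (intro conv_subst inst_terms) simp_all
    then have "conv \<Lambda> A (?B (Suc k))" using XY(3) equivclp_trans by metis
    moreover obtain s' where "typing \<Lambda> (?T # \<Gamma>) ?R (Sort s')"
      using typing_Pi_codomain[OF s] by blast
    then have "typing \<Lambda> \<Gamma> (?B (Suc k)) (Sort s')"
      unfolding BSuc using typing_subst_inst[OF _ t] by fastforce
    ultimately show ?case using IH T t by (auto simp: less_Suc_eq)
  qed
  from *[of "length Ts" A] assms
  show "i < length Ts \<Longrightarrow> typing \<Lambda> \<Gamma> (ts ! i) (subst (inst (take i ts)) (Ts ! i))"
    and "i < length Ts \<Longrightarrow> typing \<Lambda> \<Gamma> (subst (inst (take i ts)) (Ts ! i)) (Sort Star)"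
    and "conv \<Lambda> A (subst (inst ts) U)"
    by simp_all
qed

end

section \<open>Typability constraints\<close>

context confluent_calculus
begin

lemma telescope_FV:
  assumes "f \<in> Funs \<Lambda>" and "Typ \<Lambda> f = Pis Ts U"
  shows "i < length Ts \<Longrightarrow> FV (Ts ! i) \<subseteq> {..<i}" and "FV U \<subseteq> {..<length Ts}"
  using FV_Pis_nth[of Ts U 0 i] FV_Pis_body[of Ts U 0] Typ_closed[OF assms(1)] assms(2) by simp_all

text \<open>Ensures that symbolization leaves no free variable in the inferred type or in the
  equations.\<close>

lemma constraints_FV:
  "constraints \<Lambda> V hat t T E \<Longrightarrow>
   FV t \<subseteq> V \<and> FV T \<subseteq> FV t \<union> hat ` FV t \<and> (\<forall>(a, b)\<in>E. FV a \<union> FV b \<subseteq> FV t \<union> hat ` FV t)"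
proof (induction rule: constraints.induct)
  case (constraints_fun f Ts U ts As Es)
  note tele = telescope_FV[OF constraints_fun.hyps(1,2)]
  let ?W = "FV (Apps f ts) \<union> hat ` FV (Apps f ts)"
  have sub: "FV (ts ! i) \<subseteq> FV (Apps f ts)" if "i < length Ts" for i
    using that constraints_fun.hyps(3) nth_mem[of i ts] by (auto simp: FV_Apps simp del: nth_mem)
  have IH: "FV (ts ! i) \<subseteq> V" "FV (As ! i) \<subseteq> ?W" "\<forall>(a, b)\<in>Es ! i. FV a \<union> FV b \<subseteq> ?W"
    if i: "i < length Ts" for i
  proof -
    have W: "FV (ts ! i) \<union> hat ` FV (ts ! i) \<subseteq> ?W" using sub[OF i] by blast
    have "FV (ts ! i) \<subseteq> V \<and> FV (As ! i) \<subseteq> FV (ts ! i) \<union> hat ` FV (ts ! i) \<and>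
      (\<forall>(a, b)\<in>Es ! i. FV a \<union> FV b \<subseteq> FV (ts ! i) \<union> hat ` FV (ts ! i))"
      using constraints_fun.IH i by blast
    with W show "FV (ts ! i) \<subseteq> V" "FV (As ! i) \<subseteq> ?W" "\<forall>(a, b)\<in>Es ! i. FV a \<union> FV b \<subseteq> ?W"
      by blast+
  qed
  have "FV (Apps f ts) \<subseteq> V"
    using IH(1) constraints_fun.hyps(3) by (simp add: FV_Apps UN_subset_iff all_set_conv_all_nth)
  moreover have "FV (subst (inst ts) U) \<subseteq> ?W"
    using FV_subst_inst[of U ts] tele(2) constraints_fun.hyps(3) by (auto simp: FV_Apps)
  moreover have "FV (subst (inst (take i ts)) (Ts ! i)) \<subseteq> ?W" if i: "i < length Ts" for i
    using FV_subst_inst[of "Ts ! i" "take i ts"] tele(1)[OF i] constraints_fun.hyps(3) i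
      set_take_subset[of i ts]
    by (fastforce simp: FV_Apps)
  moreover have "\<forall>(a, b)\<in>\<Union> (set Es). FV a \<union> FV b \<subseteq> ?W"
    using IH(3) constraints_fun.hyps(5) by (fastforce simp: in_set_conv_nth)
  ultimately show ?case using IH(2) by blast
qed auto

text \<open>Arguments of a symbol receive types of sort \<open>Star\<close> from the telescope,
  whatever the sort of the whole term. Only a bare variable needs this of its given type, hence the
  disjunction.\<close>

lemma constraints_variable_types:
  assumes "constraints \<Lambda> V hat t T E" and "typing \<Lambda> \<Gamma> (subst \<sigma> t) A"
    and "(\<exists>f ts. t = Apps f ts) \<or> typing \<Lambda> \<Gamma> A (Sort Star)" and "x \<in> FV t"
  shows "\<exists>B. typing \<Lambda> \<Gamma> (\<sigma> x) B \<and> typing \<Lambda> \<Gamma> B (Sort Star)"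
  using assms
proof (induction arbitrary: A rule: constraints.induct)
  case (constraints_var y)
  have "Var y \<noteq> Apps f ts" for f :: 'f and ts by (cases ts rule: rev_cases) auto
  then have "typing \<Lambda> \<Gamma> A (Sort Star)" using constraints_var.prems(2) by blast
  then show ?case using constraints_var.prems by auto
next
  case (constraints_fun f Ts U ts As Es)
  have ty: "typing \<Lambda> \<Gamma> (Apps f (map (subst \<sigma>) ts)) A" and len: "length (map (subst \<sigma>) ts) = length Ts"
    using constraints_fun.prems(1) constraints_fun.hyps(3) by (simp_all add: subst_Apps)
  obtain i where i: "i < length Ts" "x \<in> FV (ts ! i)"
    using constraints_fun.prems(3) constraints_fun.hyps(3) by (auto simp: FV_Apps in_set_conv_nth)
  let ?T = "subst (inst (take i (map (subst \<sigma>) ts))) (Ts ! i)"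
  have "typing \<Lambda> \<Gamma> (subst \<sigma> (ts ! i)) ?T" "typing \<Lambda> \<Gamma> ?T (Sort Star)"
    using typing_Apps(1,2)[OF ty constraints_fun.hyps(2) len i(1)] i(1) constraints_fun.hyps(3)
    by simp_all
  then show ?case using constraints_fun.IH i by blast
qed

text \<open>If each hatted variable stands for a type of its variable, uniqueness of types settles
  the variable case. For an argument, the inferred \<open>As ! i\<close> and the expected telescope
  type are both convertible to its actual type.\<close>

lemma constraints_hold:
  assumes "constraints \<Lambda> V hat t T E" and "typing \<Lambda> \<Gamma> (subst \<sigma> t) A"
    and "\<And>x. x \<in> FV t \<Longrightarrow> typing \<Lambda> \<Gamma> (\<sigma> x) (\<sigma> (hat x))"
  shows "conv \<Lambda> A (subst \<sigma> T) \<and> (\<forall>(a, b)\<in>E. conv \<Lambda> (subst \<sigma> a) (subst \<sigma> b))"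
  using assms
proof (induction arbitrary: A rule: constraints.induct)
  case (constraints_var y)
  then show ?case by (auto intro: typing_unique)
next
  case (constraints_fun f Ts U ts As Es)
  note tele = telescope_FV[OF constraints_fun.hyps(1,2)]
  have ty: "typing \<Lambda> \<Gamma> (Apps f (map (subst \<sigma>) ts)) A" and len: "length (map (subst \<sigma>) ts) = length Ts"
    using constraints_fun.prems(1) constraints_fun.hyps(3) by (simp_all add: subst_Apps)
  note args = typing_Apps[OF ty constraints_fun.hyps(2) len]
  have "conv \<Lambda> A (subst \<sigma> (subst (inst ts) U))"
    using args(3) tele(2) constraints_fun.hyps(3) by (simp add: subst_subst_inst)
  moreover have arg: "conv \<Lambda> (subst \<sigma> (As ! i)) (subst \<sigma> (subst (inst (take i ts)) (Ts ! i)))"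
      "\<forall>(a, b)\<in>Es ! i. conv \<Lambda> (subst \<sigma> a) (subst \<sigma> b)" if i: "i < length Ts" for i
  proof -
    let ?T = "subst (inst (take i (map (subst \<sigma>) ts))) (Ts ! i)"
    have "typing \<Lambda> \<Gamma> (subst \<sigma> (ts ! i)) ?T"
      using args(1)[OF i] i constraints_fun.hyps(3) by simp
    moreover have "typing \<Lambda> \<Gamma> (\<sigma> x) (\<sigma> (hat x))" if "x \<in> FV (ts ! i)" for x
      using that i constraints_fun.hyps(3) by (intro constraints_fun.prems(2)) (auto simp: FV_Apps intro!: bexI[of _ "ts ! i"])
    ultimately have "conv \<Lambda> ?T (subst \<sigma> (As ! i)) \<and>
        (\<forall>(a, b)\<in>Es ! i. conv \<Lambda> (subst \<sigma> a) (subst \<sigma> b))"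
      using constraints_fun.IH i by blast
    \<comment> \<open>Substitution commutes with the instantiation because \<open>Ts ! i\<close> has
      no free variable outside the first \<open>i\<close> binders.\<close>
    moreover have "subst \<sigma> (subst (inst (take i ts)) (Ts ! i)) = ?T"
      using tele(1)[OF i] i constraints_fun.hyps(3) by (subst subst_subst_inst) (simp_all add: take_map)
    ultimately show "conv \<Lambda> (subst \<sigma> (As ! i)) (subst \<sigma> (subst (inst (take i ts)) (Ts ! i)))"
      "\<forall>(a, b)\<in>Es ! i. conv \<Lambda> (subst \<sigma> a) (subst \<sigma> b)"
      using equivclp_sym by auto
  qed
  moreover have "\<forall>(a, b)\<in>\<Union> (set Es). conv \<Lambda> (subst \<sigma> a) (subst \<sigma> b)"
    using arg(2) constraints_fun.hyps(5) by (fastforce simp: in_set_conv_nth)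
  ultimately show ?case by blast
qed

end

section \<open>Translating the extended calculus back\<close>

text \<open>Reading the new symbols back undoes symbolization. The assignment \<open>\<tau>\<close>
  disappears, as every free variable of \<open>a\<close> has become a symbol.\<close>

lemma interp_symbolize:
  assumes "FV a \<subseteq> FV l \<union> hat ` FV l" and "\<And>f. \<theta> (Inl f) = Fn f"
  shows "interp \<tau> \<theta> (symbolize hat l a) = subst (\<lambda>x. \<theta> (Inr x)) a"
  unfolding symbolize_def interp_subst interp_map_tm subst_eq_interp[of "\<lambda>x. \<theta> (Inr x)"]
  by (rule interp_cong) (use assms in auto)

text \<open>An instance of the interpretation lemma: old symbols stand for themselves and new ones
  for their values under \<open>\<sigma>\<close>. The hypotheses on \<open>\<sigma>\<close> type
  these values and turn the added equations into conversions.\<close>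

lemma (in confluent_calculus) typing_extended_calculus:
  assumes "typing (extended_calculus hat \<Lambda> l E) [] t A"
    and "typing \<Lambda> \<Gamma> (Sort Star) (Sort Box)"
    and types: "\<And>x. x \<in> FV l \<Longrightarrow> typing \<Lambda> \<Gamma> (\<sigma> x) (\<sigma> (hat x)) \<and> typing \<Lambda> \<Gamma> (\<sigma> (hat x)) (Sort Star)"
    and fresh: "hat ` FV l \<inter> FV l = {}"
    and FV_E: "\<forall>(a, b)\<in>E. FV a \<union> FV b \<subseteq> FV l \<union> hat ` FV l"
    and E: "\<forall>(a, b)\<in>E. conv \<Lambda> (subst \<sigma> a) (subst \<sigma> b)"
  shows "typing \<Lambda> \<Gamma> (interp Var (case_sum Fn \<sigma>) t) (interp Var (case_sum Fn \<sigma>) A)"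
proof (rule typing_interp[OF assms(1) _ assms(2)])
  let ?\<Lambda>' = "extended_calculus hat \<Lambda> l E"
  let ?\<theta> = "case_sum Fn \<sigma>"
  note ext = extended_calculus_def Let_def
  show "FV (Typ ?\<Lambda>' f) = {}" if "f \<in> Funs ?\<Lambda>'" for f
  proof (cases f)
    case (Inl g)
    with that have "g \<in> Funs \<Lambda>" by (auto simp: ext)
    then show ?thesis using Inl Typ_closed by (simp add: ext)
  qed (simp add: ext)
  show "typing \<Lambda> \<Gamma> (?\<theta> f) (interp Var ?\<theta> (Typ ?\<Lambda>' f))" if "f \<in> Funs ?\<Lambda>'" for f
  proof (cases f)
    case (Inl g)
    with that have g: "g \<in> Funs \<Lambda>" by (auto simp: ext)
    show ?thesis
      using typing_weaken_closed[OF typing.fun[OF g typing_Typ[OF g]] assms(2)] Inl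
      by (simp add: ext interp_map_tm subst_eq_interp[symmetric])
  next
    case (Inr x)
    with that have "x \<in> FV l \<union> hat ` FV l" by (auto simp: ext)
    \<comment> \<open>Freshness guarantees that a hatted symbol is declared with type
      \<open>Star\<close> and not with a hatted type of its own.\<close>
    then show ?thesis using types fresh Inr by (auto simp: ext)
  qed
  show "respects_rules ?\<Lambda>' \<Lambda> ?\<theta>"
    unfolding respects_rules_def
  proof (intro conjI ballI)
    fix f assume "f \<in> Funs ?\<Lambda>'"
    moreover have "\<sigma> x \<in> terms \<Lambda>" "\<sigma> (hat x) \<in> terms \<Lambda>" if "x \<in> FV l" for x
      using types[OF that] typing_terms[OF modulo] by blast+
    ultimately show "?\<theta> f \<in> terms \<Lambda>" by (auto simp: ext)
  next
    fix p assume p: "p \<in> Rules ?\<Lambda>'"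
    obtain a b where ab: "p = (a, b)" by (cases p)
    have "conv \<Lambda> (interp \<tau> (\<lambda>f. rename \<rho> (?\<theta> f)) a) (interp \<tau> (\<lambda>f. rename \<rho> (?\<theta> f)) b)"
      if tm: "interp \<tau> (\<lambda>f. rename \<rho> (?\<theta> f)) a \<in> terms \<Lambda>"
        "interp \<tau> (\<lambda>f. rename \<rho> (?\<theta> f)) b \<in> terms \<Lambda>" for \<rho> \<tau>
    proof -
      \<comment> \<open>The renaming introduced below binders acts after \<open>\<sigma>\<close>, so
        an interpreted equation is a renamed instance of the original one.\<close>
      have sym: "interp \<tau> (\<lambda>f. rename \<rho> (?\<theta> f)) (symbolize hat l u) = rename \<rho> (subst \<sigma> u)"
        if "FV u \<subseteq> FV l \<union> hat ` FV l" for u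
        using that by (simp add: interp_symbolize rename_subst)
      have eq: "conv \<Lambda> (rename \<rho> (subst \<sigma> u)) (rename \<rho> (subst \<sigma> v))" if "(u, v) \<in> E" for u v
        using that E by (intro conv_rename) auto
      have FV: "FV u \<subseteq> FV l \<union> hat ` FV l \<and> FV v \<subseteq> FV l \<union> hat ` FV l" if "(u, v) \<in> E" for u v
        using that FV_E by blast
      \<comment> \<open>A rule of the extended calculus is an old rule or an equation read in either
        direction; symmetry of conversion handles the reversed reading.\<close>
      from p ab consider
          u v where "(u, v) \<in> Rules \<Lambda>" "a = map_tm Inl u" "b = map_tm Inl v"
        | u v where "(u, v) \<in> E" "a = symbolize hat l u" "b = symbolize hat l v"
        | u v where "(u, v) \<in> E" "a = symbolize hat l v" "b = symbolize hat l u"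
        by (auto simp: ext)
      then show ?thesis
      proof cases
        case 1
        have "interp \<tau> (\<lambda>f. rename \<rho> (?\<theta> f)) (map_tm Inl w) = subst \<tau> w" for w
          by (simp add: interp_map_tm subst_eq_interp)
        with 1 tm show ?thesis by (auto intro!: r_into_equivclp redI step.rule)
      next
        case 2
        then show ?thesis using sym FV eq by simp
      next
        case 3
        then show ?thesis using sym FV equivclp_sym[OF eq] by simp
      qed
    qed
    then show "case p of (a, b) \<Rightarrow> \<forall>\<rho> \<tau>.
        interp \<tau> (\<lambda>f. rename \<rho> (?\<theta> f)) a \<in> terms \<Lambda> \<longrightarrow>
        interp \<tau> (\<lambda>f. rename \<rho> (?\<theta> f)) b \<in> terms \<Lambda> \<longrightarrow>
        conv \<Lambda> (interp \<tau> (\<lambda>f. rename \<rho> (?\<theta> f)) a) (interp \<tau> (\<lambda>f. rename \<rho> (?\<theta> f)) b)"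
      using ab by simp
  qed
qed simp_all

theorem theorem4p10:
  fixes \<Lambda> :: "'f calculus" and V :: "nat set" and hat :: "nat \<Rightarrow> nat"
    and l r T :: "'f tm" and E :: "('f tm \<times> 'f tm) set"
  assumes "calculus_modulo \<Lambda>"
    and "\<forall>f\<in>Funs \<Lambda>. typing \<Lambda> [] (Typ \<Lambda> f) (Sort (Srt \<Lambda> f))"
    and "confluentp (red \<Lambda>)"
    and "hat_map V hat"
    and "\<forall>(l', r')\<in>Rules \<Lambda>. pattern \<Lambda> V l'"
    and "pattern \<Lambda> V l"
    and "E \<subseteq> terms \<Lambda> \<times> terms \<Lambda>"
    and "T \<in> terms \<Lambda>"
    and "r \<in> terms \<Lambda>"
    and "FV r \<subseteq> FV l"
    and "constraints \<Lambda> V hat l T E"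
    and "typing (extended_calculus hat \<Lambda> l E) [] (symbolize hat l r) (symbolize hat l T)"
  shows "preserves_typing \<Lambda> l r"
  unfolding preserves_typing_def
proof (intro allI impI)
  fix \<Gamma> \<sigma> A assume l\<sigma>: "typing \<Lambda> \<Gamma> (subst \<sigma> l) A"
  interpret confluent_calculus \<Lambda>
    by unfold_locales (use assms(1-3,5) in \<open>unfold pattern_def, blast+\<close>)
  have Apps: "\<exists>f ts. l = Apps f ts" using assms(6) by (auto simp: pattern_def)
  have FV_l: "FV l \<subseteq> V" and FV_T: "FV T \<subseteq> FV l \<union> hat ` FV l"
    and FV_E: "\<forall>(a, b)\<in>E. FV a \<union> FV b \<subseteq> FV l \<union> hat ` FV l"
    using constraints_FV[OF assms(11)] by simp_all
  have "\<forall>x\<in>FV l. \<exists>B. typing \<Lambda> \<Gamma> (\<sigma> x) B \<and> typing \<Lambda> \<Gamma> B (Sort Star)"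
    by (intro ballI constraints_variable_types[OF assms(11) l\<sigma> disjI1[OF Apps]])
  then obtain \<tau> where \<tau>: "\<forall>x\<in>FV l. typing \<Lambda> \<Gamma> (\<sigma> x) (\<tau> x) \<and> typing \<Lambda> \<Gamma> (\<tau> x) (Sort Star)"
    unfolding bchoice_iff by (rule exE)
  \<comment> \<open>The values \<open>\<tau> x\<close> of the hatted variables are added to
    \<open>\<sigma>\<close>; \<open>inv_into V hat\<close> recovers a variable from its hat. Values
    outside \<open>FV l\<close> and its hats are arbitrary, and neither \<open>l\<close> nor
    \<open>r\<close> sees the change, since \<open>FV r \<subseteq> FV l\<close>.\<close>
  define \<sigma>' where "\<sigma>' x = (if x \<in> FV l then \<sigma> x else \<tau> (inv_into V hat x))" for x
  have fresh: "hat ` FV l \<inter> FV l = {}" using assms(4) FV_l unfolding hat_map_def by blast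
  have \<sigma>'_hat: "\<sigma>' (hat x) = \<tau> x" if "x \<in> FV l" for x
  proof -
    have "hat x \<notin> FV l" using that fresh by blast
    moreover have "inv_into V hat (hat x) = x"
      using that FV_l assms(4) unfolding hat_map_def by (intro inv_into_f_f) auto
    ultimately show ?thesis by (simp add: \<sigma>'_def)
  qed
  have types: "typing \<Lambda> \<Gamma> (\<sigma>' x) (\<sigma>' (hat x)) \<and> typing \<Lambda> \<Gamma> (\<sigma>' (hat x)) (Sort Star)"
    if "x \<in> FV l" for x
    using \<tau> that \<sigma>'_hat[OF that] by (simp add: \<sigma>'_def)
  have "subst \<sigma>' l = subst \<sigma> l" by (rule subst_cong) (simp add: \<sigma>'_def)
  with l\<sigma> have l\<sigma>': "typing \<Lambda> \<Gamma> (subst \<sigma>' l) A" by simp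
  have A: "conv \<Lambda> A (subst \<sigma>' T)" and E: "\<forall>(a, b)\<in>E. conv \<Lambda> (subst \<sigma>' a) (subst \<sigma>' b)"
    using constraints_hold[OF assms(11) l\<sigma>' conjunct1[OF types]] by simp_all
  have "typing \<Lambda> \<Gamma> (interp Var (case_sum Fn \<sigma>') (symbolize hat l r))
      (interp Var (case_sum Fn \<sigma>') (symbolize hat l T))"
    by (rule typing_extended_calculus[OF assms(12) typing_valid[OF l\<sigma>] types fresh FV_E E])
  moreover have "interp Var (case_sum Fn \<sigma>') (symbolize hat l r) = subst \<sigma>' r"
    using assms(10) by (subst interp_symbolize) auto
  moreover have "interp Var (case_sum Fn \<sigma>') (symbolize hat l T) = subst \<sigma>' T"
    using FV_T by (subst interp_symbolize) auto
  moreover have "subst \<sigma>' r = subst \<sigma> r"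
    by (rule subst_cong) (use assms(10) in \<open>auto simp: \<sigma>'_def\<close>)
  ultimately have r\<sigma>: "typing \<Lambda> \<Gamma> (subst \<sigma> r) (subst \<sigma>' T)" by simp
  \<comment> \<open>The head symbol of the pattern excludes the exceptional case in which
    \<open>A\<close> would be \<open>Box\<close>, so \<open>A\<close> has a sort, as the final
    conversion requires.\<close>
  have "subst \<sigma> l \<noteq> Sort Star" "\<And>X Y. subst \<sigma> l \<noteq> Pi X Y"
  proof -
    obtain f ts where l: "l = Apps f ts" using Apps by blast
    show "subst \<sigma> l \<noteq> Sort Star" "\<And>X Y. subst \<sigma> l \<noteq> Pi X Y"
      unfolding l by (cases ts rule: rev_cases; simp)+
  qed
  then obtain s where "typing \<Lambda> \<Gamma> A (Sort s)" using typing_type[OF l\<sigma>] by blast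
  with r\<sigma> equivclp_sym[OF A] show "typing \<Lambda> \<Gamma> (subst \<sigma> r) A" by (rule typing.conv)
qed

end
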